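(* Let $f$ be a function and suppose, with $D_n^L=D_{1,n}^L+D_{2,n}^L$: (a) $\sup_{c\in I_n}\frac{|R_{1,n}^L(c,f)|+|R_{2,n}^L(c)|}{D_n^L(c,f)}\to0$ and $\sup_{c\in I_n}\frac{|R_{3,n}(c,f)|+|R_{4,n}(c)|}{D_n^L(c,f)}\to0$ in $P_f$-probability; (b) $D_{2,n}^L$ is a good variance function (see context) with $D_{2,n}^L(c)\ge\log(nc)$ for $c\in I_n$; (c) there is a minimizer $c_n(f)$ of $c\mapsto D_n^L(c,f)+2\lambda/c$ over $c\in(0,\infty)$ that satisfies $c_n(f)\in I_n$ and $2c_n(f)\in I_n$; (d) $D_{2,n}^R(c)\asymp D_{2,n}^L(c)\asymp s_n^2(c)$ uniformly in $c\in I_n$. Then, for any sequence $M_n\to\infty$, the hierarchical posterior distribution of $f$ satisfies $$\Pi_n\Bigl(w:\|\vec w_n-\vec f_n\|^2\ge M_n\inf_{c\in I_n}\Bigl[D_n^L(c,f)+\frac1c\Bigr]\,\Big|\,\vec Y_n\Bigr)\to0\quad\text{in }P_f\text{-probability}.$$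
   Context: Setting. $\mathcal X$ is a set and for each $n$, $x_{1,n},\dots,x_{n,n}\in\mathcal X$ are known design points. For $f:\mathcal X\to\mathbb R$ write $\vec f_n=(f(x_{1,n}),\dots,f(x_{n,n}))^T$. Under $P_f$ one observes $\vec Y_n=\vec f_n+\vec\varepsilon_n$ with $\vec\varepsilon_n\sim\mathcal N_n(0,I)$. $W^1$ is a mean-zero Gaussian process on $\mathcal X$; $U_n$ is the covariance matrix of $(W^1_{x_{1,n}},\dots,W^1_{x_{n,n}})$, with orthonormal eigenbasis $e_{1,n},\dots,e_{n,n}$ and eigenvalues $\lambda_{1,n},\dots,\lambda_{n,n}$; $f_{j,n}=\vec f_n^Te_{j,n}$, $Z_{j,n}=\vec\varepsilon_n^Te_{j,n}$ (i.i.d. standard normal); $\Sigma_{n,c}=I+cU_n$. $I_n=[\log n/n,n^{m-1}]$ for a fixed constant $m\ge1$. Hierarchical Bayes: $c$ has prior density $\pi(c)\propto c^{-1-\kappa}e^{-\lambda/c}$ for $c\in I_n$ (zero elsewhere), with fixed $\kappa,\lambda>0$; given $c$, $f$ is distributed as $\sqrt c\,W^1$; given $f,c$, $\vec Y_n\sim\mathcal N_n(\vec f_n,I)$. The posterior density $\pi_n(c\mid\vec Y_n)$ of $c$ is proportional to $(\det\Sigma_{n,c})^{-1/2}e^{-\frac12\vec Y_n^T\Sigma_{n,c}^{-1}\vec Y_n}\pi(c)$. The posterior $\Pi_c(\cdot\mid\vec Y_n)$ given $c$ makes $\vec w_n\sim\mathcal N_n(\hat f_{n,c},I-\Sigma_{n,c}^{-1})$,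 $\hat f_{n,c}=(I-\Sigma_{n,c}^{-1})\vec Y_n$, and the hierarchical posterior is $\Pi_n(w:\vec w_n\in B\mid\vec Y_n)=\int\Pi_c(w:\vec w_n\in B\mid\vec Y_n)\,\pi_n(c\mid\vec Y_n)\,dc$. Functions: $D_{1,n}^L(c,f)=\sum_{j=1}^n\frac{f_{j,n}^2}{1+c\lambda_{j,n}}$, $D_{2,n}^L(c)=\sum_{j=1}^n\bigl[\log(1+c\lambda_{j,n})-\frac{c\lambda_{j,n}}{1+c\lambda_{j,n}}\bigr]$, $D_{2,n}^R(c)=\sum_{j=1}^n\frac{(c\lambda_{j,n})^2}{(1+c\lambda_{j,n})^2}$, $R_{1,n}^L(c,f)=2\sum_{j=1}^n\frac{Z_{j,n}f_{j,n}}{1+c\lambda_{j,n}}$, $R_{2,n}^L(c)=-\sum_{j=1}^n\frac{(Z_{j,n}^2-1)c\lambda_{j,n}}{1+c\lambda_{j,n}}$, $R_{3,n}(c,f)=-2\sum_{j=1}^n\frac{c\lambda_{j,n}Z_{j,n}f_{j,n}}{(1+c\lambda_{j,n})^2}$, $R_{4,n}(c)=\sum_{j=1}^n\frac{(c\lambda_{j,n})^2(Z_{j,n}^2-1)}{(1+c\lambda_{j,n})^2}$, $s_n^2(c)=\sum_{j=1}^n\frac{c\lambda_{j,n}}{1+c\lambda_{j,n}}$. Good variance function: there are $b,B,B'>0$ (independent of $n$) with $Bk^bD_{2,n}^L(c)\le D_{2,n}^L(kc)\le B'k^bD_{2,n}^L(c)$ for all $c\in I_n$ and $k\in(0,1)$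 with $kc\in I_n$. $a_n\asymp b_n$ uniformly means that $a_n/b_n$ is bounded away from $0$ and $\infty$ by the same constants over the domain, for large $n$. *)

theory Defs
  imports
    "HOL-Probability.Probability"
    "Jordan_Normal_Form.Determinant"
    "Jordan_Normal_Form.Gauss_Jordan_Elimination"
begin

(* Since n varies inside the statement, vectors and matrices of size n are those of
   Jordan_Normal_Form; their indices run over 0, ..., n - 1 instead of 1, ..., n.
   The names vec, mat and det and the infix scalar product also exist in HOL-Analysis,
   hence the qualified names. *)

definition sq_norm_v :: "real Matrix.vec \<Rightarrow> real" where
  "sq_norm_v v = scalar_prod v v"

definition mat_inv :: "real Matrix.mat \<Rightarrow> real Matrix.mat" where
  "mat_inv A = the (mat_inverse A)"


section \<open>Multivariate normal distributions\<close>

definition vec_borel :: "nat \<Rightarrow> real Matrix.vec measure" where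
  "vec_borel n =
     vimage_algebra (carrier_vec n) (\<lambda>v. \<lambda>i\<in>{..<n}. vec_index v i) (PiM {..<n} (\<lambda>_. borel))"

definition psd_mat :: "real Matrix.mat \<Rightarrow> bool" where
  "psd_mat A \<longleftrightarrow> square_mat A \<and> transpose_mat A = A \<and>
     (\<forall>v\<in>carrier_vec (dim_row A). 0 \<le> scalar_prod v (A *\<^sub>v v))"

(* A positive semidefinite matrix has exactly one positive semidefinite square root. *)
definition psd_sqrt :: "real Matrix.mat \<Rightarrow> real Matrix.mat" where
  "psd_sqrt S = (SOME A. psd_mat A \<and> A * A = S)"

(* Law of mu + S^(1/2) z for a standard normal vector z. The covariance matrix S may be
   singular, so there need not be a density. *)
definition mv_normal :: "real Matrix.vec \<Rightarrow> real Matrix.mat \<Rightarrow> real Matrix.vec measure" where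
  "mv_normal \<mu> S =
     distr (PiM {..<dim_vec \<mu>} (\<lambda>_. density lborel std_normal_density))
       (vec_borel (dim_vec \<mu>))
       (\<lambda>z. \<mu> + psd_sqrt S *\<^sub>v Matrix.vec (dim_vec \<mu>) z)"

definition has_mv_normal_law ::
  "'a measure \<Rightarrow> ('a \<Rightarrow> real Matrix.vec) \<Rightarrow> real Matrix.vec \<Rightarrow> real Matrix.mat \<Rightarrow> bool" where
  "has_mv_normal_law M X \<mu> S \<longleftrightarrow>
     X \<in> measurable M (vec_borel (dim_vec \<mu>)) \<and>
     distr M (vec_borel (dim_vec \<mu>)) X = mv_normal \<mu> S"

definition covar :: "'a measure \<Rightarrow> ('a \<Rightarrow> real) \<Rightarrow> ('a \<Rightarrow> real) \<Rightarrow> real" where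
  "covar M X Y = (\<integral>\<omega>. (X \<omega> - (\<integral>\<omega>'. X \<omega>' \<partial>M)) * (Y \<omega> - (\<integral>\<omega>'. Y \<omega>' \<partial>M)) \<partial>M)"

(* Covariance matrix of (W (t 0), ..., W (t (n - 1))). *)
definition cov_mat :: "'p measure \<Rightarrow> ('x \<Rightarrow> 'p \<Rightarrow> real) \<Rightarrow> (nat \<Rightarrow> 'x) \<Rightarrow> nat \<Rightarrow> real Matrix.mat" where
  "cov_mat M W t n = Matrix.mat n n (\<lambda>(i, j). covar M (W (t i)) (W (t j)))"

definition centered_gaussian_process :: "'p measure \<Rightarrow> ('x \<Rightarrow> 'p \<Rightarrow> real) \<Rightarrow> bool" where
  "centered_gaussian_process M W \<longleftrightarrow> prob_space M \<and>
     (\<forall>n t. has_mv_normal_law M (\<lambda>\<omega>. Matrix.vec n (\<lambda>i. W (t i) \<omega>)) (0\<^sub>v n) (cov_mat M W t n))"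


section \<open>The regression model and the hierarchical posterior\<close>

definition design_vec :: "(nat \<Rightarrow> nat \<Rightarrow> 'x) \<Rightarrow> ('x \<Rightarrow> real) \<Rightarrow> nat \<Rightarrow> real Matrix.vec" where
  "design_vec x f n = Matrix.vec n (\<lambda>i. f (x n i))"

definition orthonormal_eigenbasis ::
  "real Matrix.mat \<Rightarrow> (nat \<Rightarrow> real Matrix.vec) \<Rightarrow> (nat \<Rightarrow> real) \<Rightarrow> bool" where
  "orthonormal_eigenbasis U e l \<longleftrightarrow>
     (\<forall>j<dim_row U. e j \<in> carrier_vec (dim_row U) \<and> U *\<^sub>v e j = l j \<cdot>\<^sub>v e j) \<and>
     (\<forall>i<dim_row U. \<forall>j<dim_row U. scalar_prod (e i) (e j) = (if i = j then 1 else 0))"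

definition coords :: "(nat \<Rightarrow> real Matrix.vec) \<Rightarrow> real Matrix.vec \<Rightarrow> nat \<Rightarrow> real" where
  "coords e v j = scalar_prod v (e j)"

definition c_range :: "real \<Rightarrow> nat \<Rightarrow> real set" where
  "c_range m n = {ln (real n) / real n .. real n powr (m - 1)}"

definition Sigma_mat :: "real Matrix.mat \<Rightarrow> real \<Rightarrow> real Matrix.mat" where
  "Sigma_mat U c = 1\<^sub>m (dim_row U) + c \<cdot>\<^sub>m U"

(* Prior density of c on the range I, up to its normalizing constant, which cancels
   in the posterior density below. *)
definition prior_kernel :: "real \<Rightarrow> real \<Rightarrow> real set \<Rightarrow> real \<Rightarrow> real" where
  "prior_kernel \<kappa> l I c = indicator I c * (c powr (- 1 - \<kappa>) * exp (- l / c))"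

definition post_kernel ::
  "(real \<Rightarrow> real) \<Rightarrow> real Matrix.mat \<Rightarrow> real Matrix.vec \<Rightarrow> real \<Rightarrow> real" where
  "post_kernel p U y c =
     Determinant.det (Sigma_mat U c) powr (- 1 / 2)
       * exp (- 1 / 2 * scalar_prod y (mat_inv (Sigma_mat U c) *\<^sub>v y)) * p c"

definition post_density ::
  "(real \<Rightarrow> real) \<Rightarrow> real Matrix.mat \<Rightarrow> real Matrix.vec \<Rightarrow> real \<Rightarrow> real" where
  "post_density p U y c = post_kernel p U y c / (\<integral>c'. post_kernel p U y c' \<partial>lborel)"

definition cond_posterior ::
  "real Matrix.mat \<Rightarrow> real Matrix.vec \<Rightarrow> real \<Rightarrow> real Matrix.vec measure" where
  "cond_posterior U y c =
     (let V = 1\<^sub>m (dim_row U) - mat_inv (Sigma_mat U c) in mv_normal (V *\<^sub>v y) V)"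

definition hier_posterior ::
  "(real \<Rightarrow> real) \<Rightarrow> real Matrix.mat \<Rightarrow> real Matrix.vec \<Rightarrow> real Matrix.vec set \<Rightarrow> real" where
  "hier_posterior p U y B =
     (\<integral>c. measure (cond_posterior U y c) B * post_density p U y c \<partial>lborel)"


section \<open>Deterministic and random criterion functions\<close>

(* Here l j are the eigenvalues, g j and z j the coordinates of the vector of function
   values and of the noise vector with respect to the eigenbasis. *)

definition D1L :: "nat \<Rightarrow> (nat \<Rightarrow> real) \<Rightarrow> (nat \<Rightarrow> real) \<Rightarrow> real \<Rightarrow> real" where
  "D1L n l g c = (\<Sum>j<n. (g j)\<^sup>2 / (1 + c * l j))"

definition D2L :: "nat \<Rightarrow> (nat \<Rightarrow> real) \<Rightarrow> real \<Rightarrow> real" where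
  "D2L n l c = (\<Sum>j<n. ln (1 + c * l j) - c * l j / (1 + c * l j))"

definition DL :: "nat \<Rightarrow> (nat \<Rightarrow> real) \<Rightarrow> (nat \<Rightarrow> real) \<Rightarrow> real \<Rightarrow> real" where
  "DL n l g c = D1L n l g c + D2L n l c"

definition D2R :: "nat \<Rightarrow> (nat \<Rightarrow> real) \<Rightarrow> real \<Rightarrow> real" where
  "D2R n l c = (\<Sum>j<n. (c * l j)\<^sup>2 / (1 + c * l j)\<^sup>2)"

definition s2 :: "nat \<Rightarrow> (nat \<Rightarrow> real) \<Rightarrow> real \<Rightarrow> real" where
  "s2 n l c = (\<Sum>j<n. c * l j / (1 + c * l j))"

definition R1L :: "nat \<Rightarrow> (nat \<Rightarrow> real) \<Rightarrow> (nat \<Rightarrow> real) \<Rightarrow> (nat \<Rightarrow> real) \<Rightarrow> real \<Rightarrow> real" where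
  "R1L n l g z c = 2 * (\<Sum>j<n. z j * g j / (1 + c * l j))"

definition R2L :: "nat \<Rightarrow> (nat \<Rightarrow> real) \<Rightarrow> (nat \<Rightarrow> real) \<Rightarrow> real \<Rightarrow> real" where
  "R2L n l z c = - (\<Sum>j<n. ((z j)\<^sup>2 - 1) * (c * l j) / (1 + c * l j))"

definition R3 :: "nat \<Rightarrow> (nat \<Rightarrow> real) \<Rightarrow> (nat \<Rightarrow> real) \<Rightarrow> (nat \<Rightarrow> real) \<Rightarrow> real \<Rightarrow> real" where
  "R3 n l g z c = - 2 * (\<Sum>j<n. c * l j * z j * g j / (1 + c * l j)\<^sup>2)"

definition R4 :: "nat \<Rightarrow> (nat \<Rightarrow> real) \<Rightarrow> (nat \<Rightarrow> real) \<Rightarrow> real \<Rightarrow> real" where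
  "R4 n l z c = (\<Sum>j<n. (c * l j)\<^sup>2 * ((z j)\<^sup>2 - 1) / (1 + c * l j)\<^sup>2)"


section \<open>Asymptotic notions\<close>

definition conv_in_prob ::
  "(nat \<Rightarrow> 'w measure) \<Rightarrow> (nat \<Rightarrow> 'w \<Rightarrow> real) \<Rightarrow> real \<Rightarrow> bool" where
  "conv_in_prob P X a \<longleftrightarrow>
     (\<forall>\<epsilon>>0. (\<lambda>n. measure (P n) {\<omega> \<in> space (P n). \<bar>X n \<omega> - a\<bar> > \<epsilon>}) \<longlonglongrightarrow> 0)"

(* Conditions indexed by n are, here and below, required for all sufficiently large n only. *)
definition good_variance_function ::
  "(nat \<Rightarrow> real set) \<Rightarrow> (nat \<Rightarrow> real \<Rightarrow> real) \<Rightarrow> bool" where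
  "good_variance_function I D \<longleftrightarrow>
     (\<exists>b>0. \<exists>B>0. \<exists>B'>0. eventually (\<lambda>n. \<forall>c\<in>I n. \<forall>k\<in>{0<..<1}. k * c \<in> I n \<longrightarrow>
        B * k powr b * D n c \<le> D n (k * c) \<and> D n (k * c) \<le> B' * k powr b * D n c) sequentially)"

definition uniformly_asymp ::
  "(nat \<Rightarrow> real set) \<Rightarrow> (nat \<Rightarrow> real \<Rightarrow> real) \<Rightarrow> (nat \<Rightarrow> real \<Rightarrow> real) \<Rightarrow> bool" where
  "uniformly_asymp I a b \<longleftrightarrow>
     (\<exists>C1>0. \<exists>C2>0. eventually (\<lambda>n. \<forall>c\<in>I n. C1 \<le> a n c / b n c \<and> a n c / b n c \<le> C2) sequentially)"

end

theory Submission
  imports Defs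
begin

text \<open>In the eigenbasis everything is explicit. Markov's inequality applied to the posterior given \<open>c\<close> bounds
  the probability of the set in question by a multiple of \<open>DL c / (M * E)\<close>, where \<open>E\<close> is the
  infimum of \<open>DL c + 1 / c\<close>. The marginal likelihood of \<open>c\<close> equals
  \<open>exp (- (DL c + R1L c + R2L c) / 2)\<close> up to a factor free of \<open>c\<close>. So, where the remainders are at most
  half of \<open>DL\<close>, the posterior mass of \<open>{c. DL c + 1 / c > K * E}\<close> is exponentially small in \<open>E\<close>
  compared to that of the interval from \<open>cn\<close> to \<open>2 * cn\<close>, and \<open>E \<ge> ln n\<close> absorbs all powers of \<open>n\<close>.\<close>

section \<open>Spectral calculus in an orthonormal basis\<close>

text \<open>The interval from \<open>cn\<close> to \<open>2 * cn\<close> is chosen because only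
  \<open>D2L\<close> can grow along it: \<open>D1L\<close> and \<open>1 / c\<close> decrease, and
  the good variance property caps the growth of \<open>D2L\<close> by the factor
  \<open>2 powr b / B\<close>. The prior factor \<open>exp (- l / c)\<close> adds
  \<open>2 * l / c\<close> to minus twice the log-posterior, which is why \<open>cn\<close>
  minimizes \<open>DL c + 2 * l / c\<close>; passing from there to \<open>E\<close>, defined with
  \<open>1 / c\<close>, costs a factor \<open>max 1 (2 * l)\<close>. The tail carries
  \<open>exp (- min (1 / 4) l * K * E)\<close> against \<open>exp (- K2 * E)\<close> in the
  normalizing constant, so a large fixed \<open>K\<close> beats both \<open>K2\<close> and every
  power of \<open>n\<close>. Measurability shapes the argument. The posterior probability as a
  function of \<open>c\<close> and the hierarchical posterior as a function of the data are only
  bounded from above, where the default value 0 of \<open>measure\<close> and of the integral does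
  no harm. The exceptional events of the remainders, in contrast, must be truly measurable. A second
  difficulty is that normal laws are built on a chosen square root, which is accessible only through
  its defining equation.\<close>

locale orthonormal_basis =
  fixes n :: nat and e :: "nat \<Rightarrow> real Matrix.vec"
  assumes basis_carrier: "j < n \<Longrightarrow> e j \<in> carrier_vec n"
    and orthonormal: "i < n \<Longrightarrow> j < n \<Longrightarrow> scalar_prod (e i) (e j) = (if i = j then 1 else 0)"
begin

definition Q :: "real Matrix.mat" where
  "Q = Matrix.mat n n (\<lambda>(i, j). vec_index (e j) i)"

text \<open>Functional calculus of the basis: the symmetric matrix with eigenvalue
  \<open>a j\<close> at \<open>e j\<close>. \<open>Sigma_mat\<close>, its inverse and the posterior
  covariance all have this form, so matrix identities reduce to scalar ones.\<close>

definition spectral_mat :: "(nat \<Rightarrow> real) \<Rightarrow> real Matrix.mat" where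
  "spectral_mat a = Q * Matrix.mat n n (\<lambda>(i, j). if i = j then a i else 0) * transpose_mat Q"

lemma Q_carrier [simp]: "Q \<in> carrier_mat n n" "dim_row Q = n" "dim_col Q = n"
  by (auto simp: Q_def)

lemma square_mult_carrier [simp]:
  "A \<in> carrier_mat n n \<Longrightarrow> B \<in> carrier_mat n n \<Longrightarrow> A * B \<in> carrier_mat n n"
  "A \<in> carrier_mat n n \<Longrightarrow> v \<in> carrier_vec n \<Longrightarrow> A *\<^sub>v v \<in> carrier_vec n"
  by auto

lemma col_Q: "j < n \<Longrightarrow> col Q j = e j"
  using basis_carrier[of j] by (intro eq_vecI) (auto simp: Q_def)

lemma Q_orthogonal: "transpose_mat Q * Q = 1\<^sub>m n" "Q * transpose_mat Q = 1\<^sub>m n"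
proof -
  show *: "transpose_mat Q * Q = 1\<^sub>m n"
    by (rule eq_matI) (auto simp: col_Q orthonormal)
  show "Q * transpose_mat Q = 1\<^sub>m n"
    by (rule mat_mult_left_right_inverse[OF _ _ *]) auto
qed

lemma Q_transpose_mult: "v \<in> carrier_vec n \<Longrightarrow> j < n \<Longrightarrow> vec_index (transpose_mat Q *\<^sub>v v) j = coords e v j"
  using basis_carrier[of j] by (auto simp: col_Q coords_def intro: comm_scalar_prod)

lemma Q_Q_transpose_mult: "v \<in> carrier_vec n \<Longrightarrow> Q *\<^sub>v (transpose_mat Q *\<^sub>v v) = v"
  by (subst assoc_mult_mat_vec[symmetric, of _ n n _ n]) (auto simp: Q_orthogonal)

lemma parseval:
  assumes "v \<in> carrier_vec n" "w \<in> carrier_vec n"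
  shows "scalar_prod v w = (\<Sum>j<n. coords e v j * coords e w j)"
proof -
  have "scalar_prod v w = scalar_prod (transpose_mat Q *\<^sub>v v) (transpose_mat Q *\<^sub>v w)"
    using assms
    by (subst transpose_vec_mult_scalar[of _ n n]) (auto simp: Q_Q_transpose_mult)
  also have "\<dots> = (\<Sum>j<n. coords e v j * coords e w j)"
    unfolding scalar_prod_def using assms
    by (auto simp: atLeast0LessThan Q_transpose_mult simp del: index_mult_mat_vec intro!: sum.cong)
  finally show ?thesis .
qed

lemma parseval_sq_norm: "v \<in> carrier_vec n \<Longrightarrow> sq_norm_v v = (\<Sum>j<n. (coords e v j)\<^sup>2)"
  by (simp add: sq_norm_v_def parseval power2_eq_square)

lemma mat_eq_on_basis:
  assumes A: "A \<in> carrier_mat n n" and B: "B \<in> carrier_mat n n"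
    and "\<And>j. j < n \<Longrightarrow> A *\<^sub>v e j = B *\<^sub>v e j"
  shows "A = B"
proof -
  have "A * Q = B * Q"
  proof (rule mat_col_eqI)
    fix j assume "j < dim_col (B * Q)"
    then have "j < n" by simp
    then show "col (A * Q) j = col (B * Q) j"
      using assms by (simp add: col_mult2[of _ n n _ n] col_Q)
  qed (use A B in auto)
  then have "A * Q * transpose_mat Q = B * Q * transpose_mat Q" by simp
  then show ?thesis
    using A B by (simp add: assoc_mult_mat[of _ n n _ n _ n] Q_orthogonal)
qed

lemma spectral_mat_carrier [simp]: "spectral_mat a \<in> carrier_mat n n"
  by (auto simp: spectral_mat_def)

lemma spectral_mat_mult: "spectral_mat a * spectral_mat b = spectral_mat (\<lambda>j. a j * b j)"
proof -
  let ?D = "\<lambda>a. Matrix.mat n n (\<lambda>(i, j). if i = j then a i else 0 :: real)"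
  have D: "?D a * ?D b = ?D (\<lambda>j. a j * b j)"
    by (rule eq_matI) (auto simp: scalar_prod_def if_distrib[where f="\<lambda>x. x * _"]
        if_distrib[where f="(*) _"] cong: if_cong)
  have "spectral_mat a * spectral_mat b
      = Q * (?D a * ((transpose_mat Q * Q) * (?D b * transpose_mat Q)))"
    unfolding spectral_mat_def by (simp add: assoc_mult_mat[of _ n n _ n _ n])
  also have "\<dots> = Q * ((?D a * ?D b) * transpose_mat Q)"
    by (simp add: Q_orthogonal assoc_mult_mat[of _ n n _ n _ n])
  also have "\<dots> = spectral_mat (\<lambda>j. a j * b j)"
    unfolding D spectral_mat_def by (simp add: assoc_mult_mat[of _ n n _ n _ n])
  finally show ?thesis .
qed

lemma spectral_mat_transpose: "transpose_mat (spectral_mat a) = spectral_mat a"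
proof -
  let ?D = "Matrix.mat n n (\<lambda>(i, j). if i = j then a i else 0 :: real)"
  have "transpose_mat ?D = ?D" by (rule eq_matI) auto
  then show ?thesis
    unfolding spectral_mat_def
    by (simp add: transpose_mult[of _ n n _ n] assoc_mult_mat[of _ n n _ n _ n])
qed

lemma spectral_mat_basis:
  assumes "j < n"
  shows "spectral_mat a *\<^sub>v e j = a j \<cdot>\<^sub>v e j"
proof -
  let ?D = "Matrix.mat n n (\<lambda>(i, j). if i = j then a i else 0 :: real)"
  have 1: "transpose_mat Q *\<^sub>v e j = unit_vec n j"
    using assms basis_carrier[OF assms] by (intro eq_vecI) (auto simp: col_Q orthonormal)
  have 2: "?D *\<^sub>v unit_vec n j = a j \<cdot>\<^sub>v unit_vec n j"
    using assms by (intro eq_vecI) auto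
  have "spectral_mat a *\<^sub>v e j = Q *\<^sub>v (?D *\<^sub>v (transpose_mat Q *\<^sub>v e j))"
    unfolding spectral_mat_def using basis_carrier[OF assms]
    by (simp add: assoc_mult_mat_vec[of _ n n _ n])
  also have "\<dots> = a j \<cdot>\<^sub>v (Q *\<^sub>v unit_vec n j)"
    unfolding 1 2 by (rule mult_mat_vec[of _ n n]) auto
  also have "Q *\<^sub>v unit_vec n j = e j"
    using assms basis_carrier[OF assms]
    by (intro eq_vecI) (auto simp: Q_def)
  finally show ?thesis .
qed

lemma eq_spectral_mat:
  assumes "A \<in> carrier_mat n n" "\<And>j. j < n \<Longrightarrow> A *\<^sub>v e j = a j \<cdot>\<^sub>v e j"
  shows "A = spectral_mat a"
  using assms by (intro mat_eq_on_basis) (auto simp: spectral_mat_basis)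

lemma coords_spectral_mat_mult:
  assumes "v \<in> carrier_vec n" "j < n"
  shows "coords e (spectral_mat a *\<^sub>v v) j = a j * coords e v j"
proof -
  have "scalar_prod (spectral_mat a *\<^sub>v v) (e j) = scalar_prod v (spectral_mat a *\<^sub>v e j)"
    using transpose_vec_mult_scalar[of "spectral_mat a" n n "e j" v] assms basis_carrier[of j]
    by (simp add: spectral_mat_transpose)
  also have "\<dots> = a j * coords e v j"
    using assms basis_carrier[of j] by (simp add: spectral_mat_basis coords_def)
  finally show ?thesis by (simp add: coords_def)
qed

lemma det_spectral_mat: "Determinant.det (spectral_mat a) = (\<Prod>j<n. a j)"
proof -
  let ?D = "Matrix.mat n n (\<lambda>(i, j). if i = j then a i else 0 :: real)"
  have D: "Determinant.det ?D = (\<Prod>j<n. a j)"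
    by (subst det_lower_triangular[of n])
       (auto simp: diag_mat_def prod.distinct_set_conv_list[symmetric] atLeast0LessThan
         simp flip: prod.list_conv_set_nth intro!: prod.cong)
  have "Determinant.det Q * Determinant.det (transpose_mat Q) = Determinant.det (1\<^sub>m n)"
    by (simp add: Q_orthogonal flip: det_mult[of _ n])
  then show ?thesis
    unfolding spectral_mat_def
    by (simp add: det_mult[of _ n] D mult.assoc mult.left_commute[of _ "prod a {..<n}"])
qed

text \<open>The nonzero determinant rules out the value \<open>None\<close> of
  \<open>mat_inverse\<close>. Otherwise the left inverse it returns must coincide with the explicit
  right inverse.\<close>

lemma mat_inv_spectral_mat:
  assumes "\<And>j. j < n \<Longrightarrow> a j \<noteq> 0"
  shows "mat_inv (spectral_mat a) = spectral_mat (\<lambda>j. 1 / a j)"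
proof (cases "mat_inverse (spectral_mat a)")
  case None
  have "Determinant.det (spectral_mat a) \<noteq> 0"
    using assms by (simp add: det_spectral_mat)
  with None show ?thesis
    using mat_inverse(1)[of "spectral_mat a" n] det_non_zero_imp_unit[of "spectral_mat a" n]
    by (metis spectral_mat_carrier)
next
  case (Some B)
  then have B: "B \<in> carrier_mat n n" "B * spectral_mat a = 1\<^sub>m n"
    using mat_inverse(2)[OF spectral_mat_carrier Some] by auto
  have one: "1\<^sub>m n = spectral_mat (\<lambda>_. 1)"
    using basis_carrier by (intro eq_spectral_mat) auto
  have "spectral_mat a * spectral_mat (\<lambda>j. 1 / a j) = 1\<^sub>m n"
    unfolding spectral_mat_mult one using assms
    by (intro mat_eq_on_basis) (auto simp: spectral_mat_basis)
  then have "B = B * (spectral_mat a * spectral_mat (\<lambda>j. 1 / a j))"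
    using B by simp
  also have "\<dots> = spectral_mat (\<lambda>j. 1 / a j)"
    using B by (simp add: assoc_mult_mat[of _ n n _ n _ n, symmetric] left_mult_one_mat[of _ n n])
  finally show ?thesis by (simp add: mat_inv_def Some)
qed

lemma psd_spectral_mat:
  assumes "\<And>j. j < n \<Longrightarrow> 0 \<le> a j"
  shows "psd_mat (spectral_mat a)"
proof -
  have "0 \<le> scalar_prod v (spectral_mat a *\<^sub>v v)" if "v \<in> carrier_vec n" for v
    using that assms
    by (subst parseval)
       (auto intro!: sum_nonneg mult_nonneg_nonneg simp: coords_spectral_mat_mult mult.left_commute simp flip: power2_eq_square
          dest: mult_mat_vec_carrier[OF spectral_mat_carrier])
  then show ?thesis
    using carrier_matD[OF spectral_mat_carrier[of a]] by (simp add: psd_mat_def spectral_mat_transpose)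
qed

text \<open>Symmetry and \<open>A * A = S\<close> are all that is drawn from the choice of the root
  \<open>A\<close>. The squared Frobenius norm is the sum of the squared lengths of
  \<open>A *\<^sub>v e k\<close>, and each of these is the scalar product of \<open>e k\<close> with
  \<open>A * A\<close> applied to \<open>e k\<close>, that is \<open>a k\<close>. So the norm is the
  trace of the covariance.\<close>

lemma psd_sqrt_spectral_mat:
  assumes "\<And>j. j < n \<Longrightarrow> 0 \<le> a j"
  shows "psd_sqrt (spectral_mat a) \<in> carrier_mat n n"
    and "(\<Sum>i<n. \<Sum>j<n. (psd_sqrt (spectral_mat a) $$ (i, j))\<^sup>2) = (\<Sum>j<n. a j)"
proof -
  let ?A = "psd_sqrt (spectral_mat a)"
  have "spectral_mat (\<lambda>j. sqrt (a j)) * spectral_mat (\<lambda>j. sqrt (a j)) = spectral_mat a"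
    unfolding spectral_mat_mult using assms
    by (intro mat_eq_on_basis) (auto simp: spectral_mat_basis)
  then have "\<exists>A. psd_mat A \<and> A * A = spectral_mat a"
    using assms by (intro exI[of _ "spectral_mat (\<lambda>j. sqrt (a j))"]) (auto intro: psd_spectral_mat)
  then have A: "psd_mat ?A" "?A * ?A = spectral_mat a"
    unfolding psd_sqrt_def by (metis (mono_tags, lifting) someI_ex)+
  have "dim_row ?A = n" using arg_cong[OF A(2), of dim_row] spectral_mat_carrier[of a] by simp
  moreover have "dim_col ?A = n" using arg_cong[OF A(2), of dim_col] spectral_mat_carrier[of a] by simp
  ultimately show car: "?A \<in> carrier_mat n n" by auto
  have sym: "transpose_mat ?A = ?A" using A(1) by (simp add: psd_mat_def)
  have "(\<Sum>i<n. \<Sum>j<n. (?A $$ (i, j))\<^sup>2) = (\<Sum>i<n. sq_norm_v (row ?A i))"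
    using car by (auto simp: sq_norm_v_def scalar_prod_def power2_eq_square atLeast0LessThan intro!: sum.cong)
  also have "\<dots> = (\<Sum>i<n. \<Sum>k<n. (coords e (row ?A i) k)\<^sup>2)"
    using car by (intro sum.cong parseval_sq_norm) auto
  also have "\<dots> = (\<Sum>k<n. \<Sum>i<n. (vec_index (?A *\<^sub>v e k) i)\<^sup>2)"
    by (subst sum.swap) (use car basis_carrier in \<open>auto simp: coords_def intro!: sum.cong\<close>)
  also have "\<dots> = (\<Sum>k<n. sq_norm_v (?A *\<^sub>v e k))"
    using car by (auto simp: sq_norm_v_def scalar_prod_def power2_eq_square atLeast0LessThan intro!: sum.cong)
  also have "\<dots> = (\<Sum>k<n. a k)"
  proof (rule sum.cong)
    fix k assume "k \<in> {..<n}"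
    then have k: "k < n" "e k \<in> carrier_vec n" by (auto intro: basis_carrier)
    have "sq_norm_v (?A *\<^sub>v e k) = scalar_prod (e k) (?A *\<^sub>v (?A *\<^sub>v e k))"
      using transpose_vec_mult_scalar[of ?A n n "?A *\<^sub>v e k" "e k"] car k
      by (simp add: sq_norm_v_def sym)
    also have "?A *\<^sub>v (?A *\<^sub>v e k) = a k \<cdot>\<^sub>v e k"
      using car k by (simp add: A(2) spectral_mat_basis flip: assoc_mult_mat_vec[of _ n n _ n])
    finally show "sq_norm_v (?A *\<^sub>v e k) = a k" using k by (simp add: orthonormal)
  qed simp
  finally show "(\<Sum>i<n. \<Sum>j<n. (?A $$ (i, j))\<^sup>2) = (\<Sum>j<n. a j)" .
qed

end

section \<open>Gaussian vectors\<close>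

lemma space_vec_borel [simp]: "space (vec_borel n) = carrier_vec n"
  by (simp add: vec_borel_def)

lemma measurable_vec_index:
  assumes "i < n"
  shows "(\<lambda>v. vec_index v i) \<in> borel_measurable (vec_borel n)"
proof -
  have "(\<lambda>v. \<lambda>i\<in>{..<n}. vec_index v i) \<in> measurable (vec_borel n) (PiM {..<n} (\<lambda>_. borel :: real measure))"
    unfolding vec_borel_def by (rule measurable_vimage_algebra1) (auto simp: space_PiM)
  from measurable_compose[OF this measurable_component_singleton[of i]] assms
  show ?thesis by simp
qed

lemma measurable_vec_borelI:
  assumes "\<And>z. z \<in> space N \<Longrightarrow> g z \<in> carrier_vec n"
    and "\<And>i. i < n \<Longrightarrow> (\<lambda>z. vec_index (g z) i) \<in> borel_measurable N"
  shows "g \<in> measurable N (vec_borel n)"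
  unfolding vec_borel_def
  by (rule measurable_vimage_algebra2) (use assms in \<open>auto intro!: measurable_restrict\<close>)

section \<open>Moments of vectors of independent standard normals\<close>

abbreviation std_normal_prod :: "nat \<Rightarrow> (nat \<Rightarrow> real) measure" where
  "std_normal_prod n \<equiv> PiM {..<n} (\<lambda>_. density lborel std_normal_density)"

lemma prob_space_std_normal: "prob_space (density lborel std_normal_density)"
  by (rule prob_space_normal_density) simp

lemma prob_space_std_normal_prod: "prob_space (std_normal_prod n)"
  by (intro prob_space_PiM prob_space_std_normal)

lemma std_normal_moments:
  shows "integrable (density lborel std_normal_density) (\<lambda>x. x ^ k)"
    and "(\<integral>x. x \<partial>density lborel std_normal_density) = 0"
    and "(\<integral>x. x\<^sup>2 \<partial>density lborel std_normal_density) = 1"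
  using integrable_std_normal_moment[of k] integral_std_normal_moment_odd[of 0]
    integral_std_normal_moment_even[of 1]
  by (auto simp: integrable_real_density integral_real_density)

text \<open>By independence, integrals of monomials factor into one-dimensional moments. Means and
  covariances arise below by choosing 0, 1 or 2 as exponents.\<close>

lemma std_normal_prod_monomial:
  fixes \<alpha> :: "nat \<Rightarrow> nat"
  shows "integrable (std_normal_prod n) (\<lambda>z. \<Prod>k<n. z k ^ \<alpha> k)"
    and "(\<integral>z. (\<Prod>k<n. z k ^ \<alpha> k) \<partial>std_normal_prod n)
      = (\<Prod>k<n. \<integral>x. x ^ \<alpha> k \<partial>density lborel std_normal_density)"
proof -
  interpret product_sigma_finite "\<lambda>_::nat. density lborel std_normal_density"
    by (simp add: product_sigma_finite_def prob_space_imp_sigma_finite prob_space_std_normal)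
  show "integrable (std_normal_prod n) (\<lambda>z. \<Prod>k<n. z k ^ \<alpha> k)"
    by (rule product_integrable_prod) (auto intro: std_normal_moments)
  show "(\<integral>z. (\<Prod>k<n. z k ^ \<alpha> k) \<partial>std_normal_prod n)
      = (\<Prod>k<n. \<integral>x. x ^ \<alpha> k \<partial>density lborel std_normal_density)"
    by (rule product_integral_prod) (auto intro: std_normal_moments)
qed

lemma std_normal_prod_mean:
  assumes "i < n"
  shows "integrable (std_normal_prod n) (\<lambda>z. z i)"
    and "(\<integral>z. z i \<partial>std_normal_prod n) = 0"
proof -
  have *: "(\<lambda>z. \<Prod>k<n. z k ^ of_bool (k = i)) = (\<lambda>z. z i :: real)"
    using assms by (auto simp: fun_eq_iff prod.remove[of _ i] intro!: prod.neutral)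
  have "(\<Prod>k<n. \<integral>x. x ^ of_bool (k = i) \<partial>density lborel std_normal_density) = 0"
    by (rule prod_zero) (use assms in \<open>auto simp: std_normal_moments intro!: bexI[of _ i]\<close>)
  then show "integrable (std_normal_prod n) (\<lambda>z. z i)" "(\<integral>z. z i \<partial>std_normal_prod n) = 0"
    using std_normal_prod_monomial[where n=n and \<alpha>="\<lambda>k. of_bool (k = i)"] unfolding * by simp_all
qed

lemma std_normal_prod_covariance:
  assumes "i < n" "j < n"
  shows "integrable (std_normal_prod n) (\<lambda>z. z i * z j)"
    and "(\<integral>z. z i * z j \<partial>std_normal_prod n) = (if i = j then 1 else 0)"
proof -
  define \<alpha> :: "nat \<Rightarrow> nat" where "\<alpha> k = of_bool (k = i) + of_bool (k = j)" for k
  have one: "(\<Prod>k<n. z k ^ of_bool (k = l)) = z l" if "l < n" for l and z :: "nat \<Rightarrow> real"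
    using that by (auto simp: prod.remove[of _ l] intro!: prod.neutral)
  have *: "(\<lambda>z. \<Prod>k<n. z k ^ \<alpha> k) = (\<lambda>z. z i * z j :: real)"
    using assms by (simp add: \<alpha>_def power_add prod.distrib one)
  have "(\<Prod>k<n. \<integral>x. x ^ \<alpha> k \<partial>density lborel std_normal_density) = (if i = j then 1 else 0)"
  proof (cases "i = j")
    case True
    interpret prob_space "density lborel std_normal_density" by (rule prob_space_std_normal)
    have "(\<integral>x. x ^ \<alpha> k \<partial>density lborel std_normal_density) = 1" for k
      using True prob_space by (auto simp: \<alpha>_def std_normal_moments numeral_2_eq_2[symmetric])
    then show ?thesis using True by simp
  next
    case False
    then show ?thesis
      using assms by (auto intro!: prod_zero bexI[of _ i] simp: \<alpha>_def std_normal_moments)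
  qed
  then show "integrable (std_normal_prod n) (\<lambda>z. z i * z j)"
    "(\<integral>z. z i * z j \<partial>std_normal_prod n) = (if i = j then 1 else 0)"
    using std_normal_prod_monomial[where n=n and \<alpha>=\<alpha>] unfolding * by simp_all
qed

text \<open>Squared bias plus variance for one coordinate of a Gaussian vector; the cross terms
  vanish by the mean and covariance formulas.\<close>

lemma std_normal_prod_affine_square:
  fixes d :: real and a :: "nat \<Rightarrow> real"
  shows "integrable (std_normal_prod n) (\<lambda>z. (d + (\<Sum>j<n. a j * z j))\<^sup>2)"
    and "(\<integral>z. (d + (\<Sum>j<n. a j * z j))\<^sup>2 \<partial>std_normal_prod n) = d\<^sup>2 + (\<Sum>j<n. (a j)\<^sup>2)"
proof -
  interpret prob_space "std_normal_prod n" by (rule prob_space_std_normal_prod)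
  have *: "(d + (\<Sum>j<n. a j * z j))\<^sup>2
      = d\<^sup>2 + (\<Sum>j<n. 2 * d * a j * z j) + (\<Sum>j<n. \<Sum>k<n. a j * a k * (z j * z k))" for z
    by (simp add: power2_sum power2_eq_square[of "sum _ _"] sum_product sum_distrib_left mult_ac)
  have int': "integrable (std_normal_prod n) (\<lambda>z. \<Sum>k<n. a j * a k * (z j * z k))" if "j < n" for j
    by (intro Bochner_Integration.integrable_sum integrable_mult_right std_normal_prod_covariance)
       (use that in auto)
  have int: "integrable (std_normal_prod n) (\<lambda>z. \<Sum>j<n. 2 * d * a j * z j)"
    "integrable (std_normal_prod n) (\<lambda>z. \<Sum>j<n. \<Sum>k<n. a j * a k * (z j * z k))"
    by (intro Bochner_Integration.integrable_sum integrable_mult_right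
        std_normal_prod_mean std_normal_prod_covariance; simp)+
  show "integrable (std_normal_prod n) (\<lambda>z. (d + (\<Sum>j<n. a j * z j))\<^sup>2)"
    unfolding * by (intro Bochner_Integration.integrable_add int) simp
  show "(\<integral>z. (d + (\<Sum>j<n. a j * z j))\<^sup>2 \<partial>std_normal_prod n) = d\<^sup>2 + (\<Sum>j<n. (a j)\<^sup>2)"
    unfolding * using prob_space int int'
    by (simp add: std_normal_prod_mean std_normal_prod_covariance
        Bochner_Integration.integral_sum if_distrib[where f="(*) _"] cong: if_cong)
       (simp add: power2_eq_square)
qed

lemma measurable_affine_image:
  assumes \<mu>: "\<mu> \<in> carrier_vec n" and A: "A \<in> carrier_mat n n"
  shows "(\<lambda>z. \<mu> + A *\<^sub>v Matrix.vec n z) \<in> measurable (std_normal_prod n) (vec_borel n)"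
proof (rule measurable_vec_borelI)
  fix i assume "i < n"
  then have "vec_index (\<mu> + A *\<^sub>v Matrix.vec n z) i = vec_index \<mu> i + (\<Sum>j<n. A $$ (i, j) * z j)" for z
    using A \<mu> by (simp add: scalar_prod_def atLeast0LessThan)
  then show "(\<lambda>z. vec_index (\<mu> + A *\<^sub>v Matrix.vec n z) i) \<in> borel_measurable (std_normal_prod n)"
    by (simp only:) measurable
qed (use \<mu> A in auto)

lemma prob_space_mv_normal:
  assumes "\<mu> \<in> carrier_vec n" "psd_sqrt S \<in> carrier_mat n n"
  shows "prob_space (mv_normal \<mu> S)"
  using prob_space.prob_space_distr[OF prob_space_std_normal_prod measurable_affine_image[OF assms]] assms(1)
  by (simp add: mv_normal_def)

text \<open>Markov's inequality for the squared distance to \<open>g\<close>, whose mean is the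
  squared bias plus the total variance. The latter appears as the squared Frobenius norm of the
  root.\<close>

lemma mv_normal_markov:
  assumes \<mu>: "\<mu> \<in> carrier_vec n" and g: "g \<in> carrier_vec n"
    and A: "psd_sqrt S \<in> carrier_mat n n" and t: "0 < t"
  shows "measure (mv_normal \<mu> S) {w \<in> carrier_vec n. sq_norm_v (w - g) \<ge> t}
    \<le> (sq_norm_v (\<mu> - g) + (\<Sum>i<n. \<Sum>j<n. (psd_sqrt S $$ (i, j))\<^sup>2)) / t"
proof -
  let ?A = "psd_sqrt S" and ?N = "std_normal_prod n"
  let ?B = "{w \<in> carrier_vec n. sq_norm_v (w - g) \<ge> t}"
  let ?T = "\<lambda>z. \<mu> + ?A *\<^sub>v Matrix.vec n z"
  let ?q = "\<lambda>z. \<Sum>i<n. (vec_index \<mu> i - vec_index g i + (\<Sum>j<n. ?A $$ (i, j) * z j))\<^sup>2"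
  interpret prob_space ?N by (rule prob_space_std_normal_prod)
  have index: "vec_index (?T z) i = vec_index \<mu> i + (\<Sum>j<n. ?A $$ (i, j) * z j)" if "i < n" for z i
    using that A \<mu> by (simp add: scalar_prod_def atLeast0LessThan)
  have T [measurable]: "?T \<in> measurable ?N (vec_borel n)"
    using \<mu> A by (rule measurable_affine_image)
  have q: "sq_norm_v (?T z - g) = ?q z" for z
    unfolding sq_norm_v_def scalar_prod_def using \<mu> g A
    by (auto simp: atLeast0LessThan power2_eq_square index simp del: index_mult_mat_vec index_add_vec(1)
        intro!: sum.cong) (auto simp: scalar_prod_def atLeast0LessThan algebra_simps)
  have int_q: "integrable ?N ?q"
    by (intro Bochner_Integration.integrable_sum std_normal_prod_affine_square)
  have E_q: "(\<integral>z. ?q z \<partial>?N) = sq_norm_v (\<mu> - g) + (\<Sum>i<n. \<Sum>j<n. (?A $$ (i, j))\<^sup>2)"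
    using \<mu> g
    by (simp add: Bochner_Integration.integral_sum std_normal_prod_affine_square sum.distrib)
       (simp add: sq_norm_v_def scalar_prod_def atLeast0LessThan power2_eq_square)
  have eq: "mv_normal \<mu> S = distr ?N (vec_borel n) ?T"
    using \<mu> by (simp add: mv_normal_def)
  show ?thesis
  \<comment> \<open>Outside the sigma-algebra \<open>measure\<close> is 0 and the claimed bound is
    nonnegative, so both cases give the same estimate.\<close>
  proof (cases "?B \<in> sets (vec_borel n)")
    case True
    have "measure (mv_normal \<mu> S) ?B = measure ?N {z \<in> space ?N. t \<le> ?q z}"
      unfolding eq using True \<mu> A
      by (subst measure_distr) (auto simp: q intro!: arg_cong[where f="measure _"])
    also have "\<dots> \<le> (\<integral>z. ?q z \<partial>?N) / t"
      by (rule integral_Markov_inequality_measure[OF int_q, where A="space ?N", simplified])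
         (use t in \<open>auto intro!: sum_nonneg\<close>)
    finally show ?thesis unfolding E_q .
  next
    case False
    then have "measure (mv_normal \<mu> S) ?B = 0"
      by (simp add: eq measure_notin_sets)
    then show ?thesis
      using t by (auto simp: sq_norm_v_def scalar_prod_def intro!: divide_nonneg_nonneg add_nonneg_nonneg sum_nonneg)
  qed
qed

text \<open>Supplies the second moments of the Gaussian process, without which its covariances,
  being Bochner integrals, could be mere default values. \<open>S\<close> is arbitrary here, so
  \<open>psd_sqrt S\<close> may be an unspecified matrix.\<close>

lemma mv_normal_law_square_integrable:
  assumes M: "prob_space M" and X: "has_mv_normal_law M X (0\<^sub>v n) S" and i: "i < n"
  shows "integrable M (\<lambda>\<omega>. (vec_index (X \<omega>) i)\<^sup>2)"
proof -
  let ?A = "psd_sqrt S" and ?N = "std_normal_prod n"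
  let ?T = "\<lambda>z. 0\<^sub>v n + ?A *\<^sub>v Matrix.vec n z"
  have XM: "X \<in> measurable M (vec_borel n)" and eq: "distr M (vec_borel n) X = distr ?N (vec_borel n) ?T"
    using X by (auto simp: has_mv_normal_law_def mv_normal_def)
  \<comment> \<open>With the wrong number of rows the affine map would miss
    \<open>carrier_vec n\<close> altogether and its image measure would give the whole space mass 0,
    whereas the law of \<open>X\<close> gives it mass 1.\<close>
  have dim: "dim_row ?A = n"
  proof (rule ccontr)
    assume "dim_row ?A \<noteq> n"
    moreover have "dim_vec (?T z) = dim_row ?A" for z
      by (simp only: index_add_vec(2) dim_mult_mat_vec)
    ultimately have "?T z \<notin> carrier_vec n" for z
      by (metis carrier_vecD)
    then have "?T -` carrier_vec n \<inter> space ?N = {}"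
      by blast
    \<comment> \<open>In this hypothetical case the map is not measurable, so \<open>distr\<close>
      is unfolded: both branches of its definition yield 0.\<close>
    then have "emeasure (distr ?N (vec_borel n) ?T) (carrier_vec n) = 0"
      unfolding distr_def emeasure_measure_of_conv by simp
    moreover have "emeasure (distr M (vec_borel n) X) (carrier_vec n) = 1"
      using prob_space.emeasure_space_1[OF prob_space.prob_space_distr[OF M XM]] by simp
    ultimately show False by (simp add: eq)
  qed
  \<comment> \<open>The number of columns of \<open>?A\<close> is unknown.
    \<open>scalar_prod\<close> sums over the dimension \<open>n\<close> of its second argument, so
    the coefficients are read off from \<open>row ?A i\<close>, possibly beyond its end.\<close>
  have index: "vec_index (?T z) i = (\<Sum>j<n. vec_index (row ?A i) j * z j)" if "i < n" for i z
    using that dim by (simp add: scalar_prod_def atLeast0LessThan)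
  have T: "?T \<in> measurable ?N (vec_borel n)"
  proof (rule measurable_vec_borelI)
    fix i assume "i < n"
    then show "(\<lambda>z. vec_index (?T z) i) \<in> borel_measurable ?N"
      by (simp only: index) measurable
  next
    fix z
    have "dim_vec (?T z) = n" by (simp only: index_add_vec(2) dim_mult_mat_vec dim)
    then show "?T z \<in> carrier_vec n" by (rule carrier_vecI)
  qed
  have meas: "(\<lambda>v. (vec_index v i)\<^sup>2) \<in> borel_measurable (vec_borel n)"
    using measurable_vec_index[OF i] by (rule borel_measurable_power)
  have "integrable ?N (\<lambda>z. (vec_index (?T z) i)\<^sup>2)"
    using std_normal_prod_affine_square(1)[of n 0 "\<lambda>j. vec_index (row ?A i) j"]
    by (simp only: index[OF i] add_0)
  then have "integrable (distr ?N (vec_borel n) ?T) (\<lambda>v. (vec_index v i)\<^sup>2)"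
    by (simp only: integrable_distr_eq[OF T meas])
  then show ?thesis
    by (simp only: eq[symmetric] integrable_distr_eq[OF XM meas])
qed

text \<open>For a unit eigenvector \<open>v\<close> the eigenvalue is the quadratic form of the
  covariance matrix at \<open>v\<close>, that is the variance of the combination of the
  \<open>W (t i)\<close> with weights \<open>v\<close>. Integrability justifies pulling the finite
  sums into the integral.\<close>

lemma cov_mat_eigenvalue_nonneg:
  assumes W: "centered_gaussian_process M W"
    and v: "v \<in> carrier_vec n" "scalar_prod v v = 1" "cov_mat M W t n *\<^sub>v v = a \<cdot>\<^sub>v v"
  shows "0 \<le> a"
proof -
  interpret prob_space M using W by (simp add: centered_gaussian_process_def)
  \<comment> \<open>One-point marginals suffice: they give measurability and square integrability of
    each \<open>W s\<close>, and products of two centered values are dominated by the sum of their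
    squares.\<close>
  have law: "has_mv_normal_law M (\<lambda>\<omega>. Matrix.vec 1 (\<lambda>i. W s \<omega>)) (0\<^sub>v 1) (cov_mat M W (\<lambda>_. s) 1)" for s
    using W[unfolded centered_gaussian_process_def, THEN conjunct2, THEN spec[of _ 1], THEN spec[of _ "\<lambda>_. s"]]
    by simp
  have sq: "integrable M (\<lambda>\<omega>. (W s \<omega>)\<^sup>2)" for s
    using mv_normal_law_square_integrable[OF prob_space_axioms law, of 0 s] by simp
  have meas: "W s \<in> borel_measurable M" for s
  proof -
    have "(\<lambda>\<omega>. Matrix.vec 1 (\<lambda>i. W s \<omega>)) \<in> measurable M (vec_borel 1)"
      using law[of s] by (simp add: has_mv_normal_law_def)
    from measurable_compose[OF this measurable_vec_index[of 0]] show ?thesis by simp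
  qed
  let ?C = "\<lambda>i \<omega>. W (t i) \<omega> - (\<integral>\<omega>'. W (t i) \<omega>' \<partial>M)"
  have int_W: "integrable M (W s)" for s
    using square_integrable_imp_integrable[OF meas sq] .
  have sqC: "integrable M (\<lambda>\<omega>. (?C i \<omega>)\<^sup>2)" for i
    using int_W[of "t i"] sq[of "t i"] by (simp add: power2_diff)
  have prodC: "integrable M (\<lambda>\<omega>. ?C i \<omega> * ?C j \<omega>)" for i j
  proof (rule Bochner_Integration.integrable_bound)
    show "integrable M (\<lambda>\<omega>. (?C i \<omega>)\<^sup>2 + (?C j \<omega>)\<^sup>2)"
      by (intro Bochner_Integration.integrable_add sqC)
    have "\<bar>x * y\<bar> \<le> \<bar>x\<^sup>2 + y\<^sup>2\<bar>" for x y :: real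
      using sum_squares_bound[of "\<bar>x\<bar>" "\<bar>y\<bar>"] mult_nonneg_nonneg[of "\<bar>x\<bar>" "\<bar>y\<bar>"]
      by (simp add: abs_mult del: mult_nonneg_nonneg)
    then show "AE \<omega> in M. norm (?C i \<omega> * ?C j \<omega>) \<le> norm ((?C i \<omega>)\<^sup>2 + (?C j \<omega>)\<^sup>2)" by simp
  qed (use meas in measurable)
  have "a = scalar_prod v (cov_mat M W t n *\<^sub>v v)" using v by simp
  also have "\<dots> = (\<Sum>i<n. \<Sum>j<n. vec_index v i * vec_index v j * (\<integral>\<omega>. ?C i \<omega> * ?C j \<omega> \<partial>M))"
    using v(1) by (simp add: cov_mat_def scalar_prod_def covar_def atLeast0LessThan sum_distrib_left mult_ac)
  also have "\<dots> = (\<integral>\<omega>. (\<Sum>i<n. \<Sum>j<n. vec_index v i * vec_index v j * (?C i \<omega> * ?C j \<omega>)) \<partial>M)"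
    using prodC by (simp add: Bochner_Integration.integral_sum)
  also have "\<dots> = (\<integral>\<omega>. (\<Sum>i<n. vec_index v i * ?C i \<omega>)\<^sup>2 \<partial>M)"
    by (simp add: power2_eq_square sum_product mult_ac)
  finally show ?thesis by simp
qed

section \<open>The posterior in the eigenbasis\<close>

locale spectral_covariance = orthonormal_basis +
  fixes U :: "real Matrix.mat" and ev :: "nat \<Rightarrow> real"
  assumes U_carrier: "U \<in> carrier_mat n n"
    and eigen: "j < n \<Longrightarrow> U *\<^sub>v e j = ev j \<cdot>\<^sub>v e j"
    and ev_nonneg: "j < n \<Longrightarrow> 0 \<le> ev j"
begin

lemma one_plus_pos: "0 \<le> c \<Longrightarrow> j < n \<Longrightarrow> 0 < 1 + c * ev j"
  using ev_nonneg[of j] by (intro add_pos_nonneg mult_nonneg_nonneg) auto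

lemma Sigma_mat_spectral: "Sigma_mat U c = spectral_mat (\<lambda>j. 1 + c * ev j)"
proof (rule eq_spectral_mat)
  show "Sigma_mat U c \<in> carrier_mat n n"
    using U_carrier by (simp add: Sigma_mat_def)
  fix j assume j: "j < n"
  have "(c \<cdot>\<^sub>m U) *\<^sub>v e j = c \<cdot>\<^sub>v (U *\<^sub>v e j)"
    using U_carrier basis_carrier[OF j] by (intro eq_vecI) auto
  then have "Sigma_mat U c *\<^sub>v e j = e j + c \<cdot>\<^sub>v (ev j \<cdot>\<^sub>v e j)"
    using U_carrier basis_carrier[OF j]
    by (simp add: Sigma_mat_def add_mult_distrib_mat_vec[of _ n n] eigen[OF j])
  then show "Sigma_mat U c *\<^sub>v e j = (1 + c * ev j) \<cdot>\<^sub>v e j"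
    using basis_carrier[OF j] by (auto simp: algebra_simps)
qed

lemma mat_inv_Sigma_mat:
  assumes "0 \<le> c"
  shows "mat_inv (Sigma_mat U c) = spectral_mat (\<lambda>j. 1 / (1 + c * ev j))"
  unfolding Sigma_mat_spectral by (rule mat_inv_spectral_mat) (use one_plus_pos[OF assms] in force)

lemma posterior_covariance_spectral:
  assumes "0 \<le> c"
  shows "1\<^sub>m (dim_row U) - mat_inv (Sigma_mat U c) = spectral_mat (\<lambda>j. c * ev j / (1 + c * ev j))"
proof (rule eq_spectral_mat)
  show "1\<^sub>m (dim_row U) - mat_inv (Sigma_mat U c) \<in> carrier_mat n n"
    by (simp add: mat_inv_Sigma_mat[OF assms] minus_carrier_mat)
  fix j assume j: "j < n"
  have "(1\<^sub>m (dim_row U) - mat_inv (Sigma_mat U c)) *\<^sub>v e j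
      = e j - (1 / (1 + c * ev j)) \<cdot>\<^sub>v e j"
    using U_carrier basis_carrier[OF j]
    by (simp add: mat_inv_Sigma_mat[OF assms] minus_mult_distrib_mat_vec[of _ n n] spectral_mat_basis[OF j])
  also have "\<dots> = (c * ev j / (1 + c * ev j)) \<cdot>\<^sub>v e j"
    using basis_carrier[OF j] one_plus_pos[OF assms j] by (intro eq_vecI) (auto simp: field_simps)
  finally show "(1\<^sub>m (dim_row U) - mat_inv (Sigma_mat U c)) *\<^sub>v e j
      = (c * ev j / (1 + c * ev j)) \<cdot>\<^sub>v e j" .
qed

lemma coords_add: "v \<in> carrier_vec n \<Longrightarrow> w \<in> carrier_vec n \<Longrightarrow> j < n \<Longrightarrow>
    coords e (v + w) j = coords e v j + coords e w j"
  using basis_carrier[of j] by (simp add: coords_def add_scalar_prod_distrib)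

lemma coords_diff: "v \<in> carrier_vec n \<Longrightarrow> w \<in> carrier_vec n \<Longrightarrow> j < n \<Longrightarrow>
    coords e (v - w) j = coords e v j - coords e w j"
  using basis_carrier[of j] by (simp add: coords_def minus_scalar_prod_distrib)

lemma prob_space_cond_posterior:
  assumes c: "0 \<le> c" and y: "y \<in> carrier_vec n"
  shows "prob_space (cond_posterior U y c)"
  unfolding cond_posterior_def posterior_covariance_spectral[OF c] Let_def
  using y c ev_nonneg by (intro prob_space_mv_normal[where n=n] psd_sqrt_spectral_mat) auto

text \<open>Markov's inequality and the bias-variance decomposition of the posterior mean in the eigenbasis.\<close>
lemma cond_posterior_markov:
  assumes c: "0 \<le> c" and g: "g \<in> carrier_vec n" and z: "z \<in> carrier_vec n" and t: "0 < t"
  shows "measure (cond_posterior U (g + z) c) {w \<in> carrier_vec n. sq_norm_v (w - g) \<ge> t}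
    \<le> (D1L n ev (coords e g) c + R3 n ev (coords e g) (coords e z) c
        + D2R n ev c + R4 n ev (coords e z) c + s2 n ev c) / t"
proof -
  let ?r = "\<lambda>j. c * ev j / (1 + c * ev j)" and ?g = "coords e g" and ?z = "coords e z"
  let ?V = "spectral_mat ?r"
  have r: "0 \<le> ?r j" if "j < n" for j
    using c ev_nonneg[OF that] by simp
  have "sq_norm_v (?V *\<^sub>v (g + z) - g) = (\<Sum>j<n. (?r j * (?g j + ?z j) - ?g j)\<^sup>2)"
    using g z by (subst parseval_sq_norm) (auto simp: coords_diff coords_add coords_spectral_mat_mult)
  also have "\<dots> \<le> (\<Sum>j<n. (?g j)\<^sup>2 / (1 + c * ev j) - 2 * (c * ev j * ?z j * ?g j / (1 + c * ev j)\<^sup>2)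
      + (c * ev j)\<^sup>2 / (1 + c * ev j)\<^sup>2 + (c * ev j)\<^sup>2 * ((?z j)\<^sup>2 - 1) / (1 + c * ev j)\<^sup>2)"
  proof (rule sum_mono)
    fix j assume "j \<in> {..<n}"
    then have p: "0 \<le> c * ev j" using c ev_nonneg[of j] by simp
    define x where "x = c * ev j"
    have x: "1 + x > 0" "x \<ge> 0" using p by (auto simp: x_def)
    have "(x / (1 + x) * (?g j + ?z j) - ?g j)\<^sup>2 = ((x * ?z j - ?g j) / (1 + x))\<^sup>2"
      using x by (simp add: field_simps)
    \<comment> \<open>Writing the squared noise as 1 plus its centered part splits the variance of
      the posterior mean into the terms of \<open>D2R\<close> and \<open>R4\<close>; the mixed term
      is that of \<open>R3\<close>.\<close>
    also have "\<dots> = (?g j)\<^sup>2 / (1 + x)\<^sup>2 - 2 * (x * ?z j * ?g j / (1 + x)\<^sup>2)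
        + x\<^sup>2 / (1 + x)\<^sup>2 + x\<^sup>2 * ((?z j)\<^sup>2 - 1) / (1 + x)\<^sup>2"
    proof -
      have "(x * ?z j - ?g j)\<^sup>2 = (?g j)\<^sup>2 - 2 * (x * ?z j * ?g j) + x\<^sup>2 + x\<^sup>2 * ((?z j)\<^sup>2 - 1)"
        by (simp add: power2_eq_square algebra_simps)
      then show ?thesis
        by (subst power_divide) (simp only:, simp add: add_divide_distrib diff_divide_distrib)
    qed
    \<comment> \<open>The squared bias comes with the square of \<open>1 + x\<close>; giving up one
      of these factors, each at least 1, produces \<open>D1L\<close>.\<close>
    also have "(?g j)\<^sup>2 / (1 + x)\<^sup>2 \<le> (?g j)\<^sup>2 / (1 + x)"
      using x self_le_power[of "1 + x" 2] by (intro divide_left_mono) auto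
    finally show "(?r j * (?g j + ?z j) - ?g j)\<^sup>2 \<le> (?g j)\<^sup>2 / (1 + c * ev j)
      - 2 * (c * ev j * ?z j * ?g j / (1 + c * ev j)\<^sup>2)
      + (c * ev j)\<^sup>2 / (1 + c * ev j)\<^sup>2 + (c * ev j)\<^sup>2 * ((?z j)\<^sup>2 - 1) / (1 + c * ev j)\<^sup>2"
      by (simp add: x_def)
  qed
  also have "\<dots> = D1L n ev ?g c + R3 n ev ?g ?z c + D2R n ev c + R4 n ev ?z c"
    by (simp add: D1L_def R3_def D2R_def R4_def sum.distrib sum_subtractf sum_distrib_left sum_negf)
  finally have "sq_norm_v (?V *\<^sub>v (g + z) - g) + (\<Sum>j<n. ?r j)
      \<le> D1L n ev ?g c + R3 n ev ?g ?z c + D2R n ev c + R4 n ev ?z c + s2 n ev c"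
    by (simp add: s2_def)
  moreover have "measure (cond_posterior U (g + z) c) {w \<in> carrier_vec n. sq_norm_v (w - g) \<ge> t}
      \<le> (sq_norm_v (?V *\<^sub>v (g + z) - g) + (\<Sum>j<n. ?r j)) / t"
    using mv_normal_markov[OF _ g _ t, of "?V *\<^sub>v (g + z)" ?V] g z
      psd_sqrt_spectral_mat[of ?r] r
    by (simp add: cond_posterior_def posterior_covariance_spectral[OF c] Let_def)
  ultimately show ?thesis
    using t by (meson divide_right_mono less_imp_le order_trans)
qed

text \<open>With \<open>x = c * ev j\<close>, minus twice the log-likelihood is the sum of
  \<open>ln (1 + x)\<close> and \<open>(g + z)^2 / (1 + x)\<close>. Splitting
  \<open>z^2 / (1 + x)\<close> into \<open>z^2 - z^2 * x / (1 + x)\<close> isolates a part free of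
  \<open>c\<close>, and centering \<open>z^2\<close> at its mean 1 in the rest gives the
  \<open>x / (1 + x)\<close> of \<open>D2L\<close> and the summand of \<open>R2L\<close>.\<close>

lemma post_kernel_spectral:
  assumes c: "0 \<le> c" and g: "g \<in> carrier_vec n" and z: "z \<in> carrier_vec n"
  shows "post_kernel p U (g + z) c = exp (- (\<Sum>j<n. (coords e z j)\<^sup>2) / 2)
    * exp (- (DL n ev (coords e g) c + (R1L n ev (coords e g) (coords e z) c + R2L n ev (coords e z) c)) / 2) * p c"
proof -
  let ?g = "coords e g" and ?z = "coords e z"
  note pos = one_plus_pos[OF c]
  have "ln (\<Prod>j<n. 1 + c * ev j) = (\<Sum>j<n. ln (1 + c * ev j))"
    using pos by (intro ln_prod) (auto simp: order_less_le)
  moreover have "0 < (\<Prod>j<n. 1 + c * ev j)"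
    using pos by (intro prod_pos) auto
  ultimately have det: "Determinant.det (Sigma_mat U c) powr (- 1 / 2) = exp (- (\<Sum>j<n. ln (1 + c * ev j)) / 2)"
    by (auto simp: Sigma_mat_spectral det_spectral_mat powr_def order_less_le)
  have "scalar_prod (g + z) (mat_inv (Sigma_mat U c) *\<^sub>v (g + z)) = (\<Sum>j<n. (?g j + ?z j)\<^sup>2 / (1 + c * ev j))"
    using g z by (subst parseval)
      (auto simp: mat_inv_Sigma_mat[OF c] coords_spectral_mat_mult coords_add power2_eq_square intro!: sum.cong)
  also have "\<dots> + (\<Sum>j<n. ln (1 + c * ev j)) = (\<Sum>j<n. (?z j)\<^sup>2)
      + (DL n ev ?g c + (R1L n ev ?g ?z c + R2L n ev ?z c))"
    unfolding DL_def D1L_def D2L_def R1L_def R2L_def sum_distrib_left sum_negf[symmetric] sum.distrib[symmetric]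
  proof (intro sum.cong refl)
    fix j assume "j \<in> {..<n}"
    then have "1 + c * ev j > 0" using pos by auto
    moreover define x where "x = c * ev j"
    ultimately have x: "1 + x > 0" by simp
    have "(?z j)\<^sup>2 = (?z j)\<^sup>2 / (1 + x) + (?z j)\<^sup>2 * x / (1 + x)"
    proof -
      have "1 + x \<noteq> 0" using x by simp
      then show ?thesis by (simp add: eq_divide_eq ring_distribs flip: add_divide_distrib)
    qed
    then have "(?g j + ?z j)\<^sup>2 / (1 + x) + ln (1 + x) =
        (?z j)\<^sup>2 + ((?g j)\<^sup>2 / (1 + x) + (ln (1 + x) - x / (1 + x)) + (2 * (?z j * ?g j / (1 + x))
        + - (((?z j)\<^sup>2 - 1) * x / (1 + x))))"
      by (simp add: power2_sum add_divide_distrib diff_divide_distrib algebra_simps)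
    then show "(?g j + ?z j)\<^sup>2 / (1 + c * ev j) + ln (1 + c * ev j) =
        (?z j)\<^sup>2 + ((?g j)\<^sup>2 / (1 + c * ev j) + (ln (1 + c * ev j) - c * ev j / (1 + c * ev j))
        + (2 * (?z j * ?g j / (1 + c * ev j)) + - (((?z j)\<^sup>2 - 1) * (c * ev j) / (1 + c * ev j))))"
      by (simp add: x_def)
  qed
  finally have eq: "scalar_prod (g + z) (mat_inv (Sigma_mat U c) *\<^sub>v (g + z))
      = (\<Sum>j<n. (?z j)\<^sup>2) + (DL n ev ?g c + (R1L n ev ?g ?z c + R2L n ev ?z c)) - (\<Sum>j<n. ln (1 + c * ev j))"
    by linarith
  show ?thesis
    unfolding post_kernel_def det eq exp_add[symmetric] by (simp add: field_simps flip: exp_add)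
qed

end

section \<open>Concentration of the posterior of the scale\<close>

text \<open>The Bochner integral of a non-integrable function is 0, so the bound also holds for such \<open>f\<close>.\<close>
lemma abs_integral_le_dominated:
  fixes f g :: "'a \<Rightarrow> real"
  assumes "integrable M g" "\<And>x. 0 \<le> f x" "\<And>x. f x \<le> g x"
  shows "\<bar>integral\<^sup>L M f\<bar> \<le> integral\<^sup>L M g"
proof (cases "integrable M f")
  case True
  then have "integral\<^sup>L M f \<le> integral\<^sup>L M g" using assms by (intro integral_mono) auto
  moreover have "0 \<le> integral\<^sup>L M f" using assms by (intro Bochner_Integration.integral_nonneg) auto
  ultimately show ?thesis by simp
next
  case False
  have "0 \<le> integral\<^sup>L M g"
    using assms by (intro Bochner_Integration.integral_nonneg) (auto intro: order_trans)
  then show ?thesis using False by (simp add: not_integrable_integral_eq)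
qed

text \<open>The part of the posterior of \<open>c\<close> with \<open>D c + 1 / c \<le> K * E\<close> is bounded through \<open>K1\<close>. The rest
  has mass exponentially small in \<open>K * E\<close>, whereas the interval from \<open>cn\<close> to \<open>2 * cn\<close> alone contributes at least
  a multiple of \<open>exp (- K2 * E)\<close> to the normalizing constant.\<close>
lemma hierarchical_integral_bound:
  fixes D R h k :: "real \<Rightarrow> real"
  assumes ab: "0 < a" "a \<le> b" and \<kappa>: "0 < \<kappa>" and l: "0 < l" and K0: "0 < K0"
    and k: "\<And>c. 0 \<le> c \<Longrightarrow> k c = K0 * exp (- (D c + R c) / 2) * prior_kernel \<kappa> l {a..b} c"
    and k_neg: "\<And>c. c < 0 \<Longrightarrow> k c = 0"
    and cont: "continuous_on {a..b} (\<lambda>c. D c + R c)"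
    and D: "\<And>c. c \<in> {a..b} \<Longrightarrow> 0 \<le> D c"
    and R: "\<And>c. c \<in> {a..b} \<Longrightarrow> \<bar>R c\<bar> \<le> D c / 2"
    and h: "\<And>c. 0 \<le> h c" "\<And>c. c \<in> {a..b} \<Longrightarrow> h c \<le> 1"
      "\<And>c. c \<in> {a..b} \<Longrightarrow> h c \<le> K1 * D c / (M * E)"
    and K1: "0 \<le> K1" and M: "0 < M" and E: "0 < E" and K: "0 \<le> K"
    and cn: "cn \<in> {a..b}" "2 * cn \<in> {a..b}"
    and K2: "\<And>c. c \<in> {cn..2 * cn} \<Longrightarrow> D c + 2 * l / c \<le> K2 * E"
  shows "\<bar>\<integral>c. h c * (k c / (\<integral>c'. k c' \<partial>lborel)) \<partial>lborel\<bar>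
    \<le> K1 * K / M + (b - a) * a powr (- 1 - \<kappa>) * exp (- min (1 / 4) l * K * E)
        / (cn * (2 * cn) powr (- 1 - \<kappa>) * exp (- K2 * E))"
proof -
  let ?Z = "\<integral>c. k c \<partial>lborel" and ?k0 = "min (1 / 4) l"
  have cn0: "0 < cn" using cn ab by auto
  define q where "q c = K0 * exp (- (D c + R c) / 2) * (c powr (- 1 - \<kappa>) * exp (- l / c))" for c
  have k_eq: "k c = indicator {a..b} c * q c" for c
  proof (cases "0 \<le> c")
    case True
    then show ?thesis by (simp add: k q_def prior_kernel_def)
  next
    case False
    then show ?thesis using ab by (simp add: k_neg indicator_def)
  qed
  have q0: "0 \<le> q c" for c using K0 by (simp add: q_def)
  have cont_q: "continuous_on {a..b} q"
    unfolding q_def using ab by (intro continuous_intros cont) auto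
  have int_k: "integrable lborel k"
    using borel_integrable_atLeastAtMost'[OF cont_q]
    by (simp add: set_integrable_def k_eq[abs_def])
  \<comment> \<open>Since \<open>R c\<close> is at least \<open>- D c / 2\<close>, the likelihood
    exponent is at most \<open>- D c / 4\<close>, and the prior adds \<open>- l / c\<close>. The
    smaller of the coefficients 1/4 and \<open>l\<close> serves for both parts of
    \<open>D c + 1 / c\<close>. The power in the prior is largest at the left end
    \<open>a\<close>.\<close>
  have tail_bound: "q c \<le> K0 * (a powr (- 1 - \<kappa>) * exp (- ?k0 * (D c + 1 / c)))" if c: "c \<in> {a..b}" for c
  proof -
    have c0: "0 < c" using c ab by auto
    have "?k0 * D c \<le> 1 / 4 * D c" "?k0 * (1 / c) \<le> l * (1 / c)"
      using D[OF c] c0 by (intro mult_right_mono; simp)+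
    moreover have "- (D c + R c) / 2 \<le> - (1 / 4 * D c)"
      using R[OF c, THEN abs_le_D2] by simp
    ultimately have "- (D c + R c) / 2 + - (l * (1 / c)) \<le> - (?k0 * D c) + - (?k0 * (1 / c))"
      by (intro add_mono) linarith+
    then have "- (D c + R c) / 2 + - l / c \<le> - ?k0 * (D c + 1 / c)"
      by (simp add: ring_distribs)
    then have e: "exp (- (D c + R c) / 2) * exp (- l / c) \<le> exp (- ?k0 * (D c + 1 / c))"
      by (simp flip: exp_add)
    have p: "c powr (- 1 - \<kappa>) \<le> a powr (- 1 - \<kappa>)"
      using c ab \<kappa> by (intro powr_mono2') auto
    have "c powr (- 1 - \<kappa>) * (exp (- (D c + R c) / 2) * exp (- l / c))
        \<le> a powr (- 1 - \<kappa>) * exp (- ?k0 * (D c + 1 / c))"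
      using e p by (intro mult_mono) auto
    then show ?thesis
      using K0 by (simp add: q_def mult_ac)
  qed
  \<comment> \<open>Here \<open>(D c + R c) / 2\<close> is at most \<open>3 / 4 * D c\<close>, hence
    at most \<open>D c\<close>, and \<open>l / c\<close> is below \<open>2 * l / c\<close>, so
    \<open>K2 * E\<close> bounds the whole exponent. The decreasing power is smallest at
    \<open>2 * cn\<close>.\<close>
  have lower: "K0 * ((2 * cn) powr (- 1 - \<kappa>) * exp (- K2 * E)) \<le> q c" if c: "c \<in> {cn..2 * cn}" for c
  proof -
    have c': "c \<in> {a..b}" using c cn by auto
    have c0: "0 < c" using c cn0 by auto
    define u where "u = l / c"
    have u: "0 \<le> u" "D c + 2 * u \<le> K2 * E" using l c0 K2[OF c] by (simp_all add: u_def)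
    have "- D c \<le> - (D c + R c) / 2"
      using R[OF c', THEN abs_le_D1] D[OF c'] by simp
    then have "- (K2 * E) \<le> - (D c + R c) / 2 + - u"
      using u by linarith
    then have "- K2 * E \<le> - (D c + R c) / 2 + - l / c" by (simp add: u_def)
    then have e: "exp (- K2 * E) \<le> exp (- (D c + R c) / 2) * exp (- l / c)"
      by (simp flip: exp_add)
    have p: "(2 * cn) powr (- 1 - \<kappa>) \<le> c powr (- 1 - \<kappa>)"
      using c c0 \<kappa> by (intro powr_mono2') auto
    have "(2 * cn) powr (- 1 - \<kappa>) * exp (- K2 * E) \<le> c powr (- 1 - \<kappa>) * (exp (- (D c + R c) / 2) * exp (- l / c))"
      using e p by (intro mult_mono) auto
    then show ?thesis
      using K0 by (simp add: q_def mult_ac)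
  qed
  have int_ind: "integrable lborel (indicat_real {u..v})" for u v :: real
    by (rule integrable_real_indicator) (auto simp: emeasure_lborel_Icc_eq)
  define L where "L = K0 * ((2 * cn) powr (- 1 - \<kappa>) * exp (- K2 * E))"
  have L0: "0 < L" using K0 cn0 by (simp add: L_def)
  have "(\<integral>c. indicator {cn..2 * cn} c * L \<partial>lborel) \<le> ?Z"
  proof (rule integral_mono)
    show "indicator {cn..2 * cn} c * L \<le> k c" for c
      using lower[of c] q0[of c] cn by (auto simp: k_eq L_def indicator_def)
  qed (auto simp: int_k int_ind)
  moreover have "(\<integral>c. indicator {cn..2 * cn} c * L \<partial>lborel) = cn * L"
    using cn0 by simp
  ultimately have Z: "cn * L \<le> ?Z" by linarith
  have Z0: "0 < ?Z" using Z mult_pos_pos[OF cn0 L0] by linarith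
  define T where "T = K0 * (a powr (- 1 - \<kappa>) * exp (- ?k0 * K * E))"
  have T0: "0 \<le> T" using K0 by (simp add: T_def)
  \<comment> \<open>Nothing is known about the measurability of \<open>h\<close>, so only the
    dominating function is required to be integrable: a multiple of \<open>k\<close> for the good
    \<open>c\<close>, the constant \<open>T\<close> for the others.\<close>
  have "\<bar>\<integral>c. h c * (k c / ?Z) \<partial>lborel\<bar> \<le> (\<integral>c. (K1 * K / M * k c + indicator {a..b} c * T) / ?Z \<partial>lborel)"
  proof (rule abs_integral_le_dominated)
    show "integrable lborel (\<lambda>c. (K1 * K / M * k c + indicator {a..b} c * T) / ?Z)"
      by (intro integrable_divide Bochner_Integration.integrable_add integrable_mult_right integrable_mult_left int_k int_ind)
    fix c
    show "0 \<le> h c * (k c / ?Z)"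
      using h(1)[of c] q0[of c] Z0 by (simp add: k_eq)
    have "h c * k c \<le> K1 * K / M * k c + indicator {a..b} c * T"
    proof (cases "c \<in> {a..b}")
      case c: True
      show ?thesis
      proof (cases "D c + 1 / c \<le> K * E")
        case True
        moreover have "0 \<le> 1 / c" using c ab by simp
        ultimately have "D c \<le> K * E" by linarith
        then have "K1 * D c / (M * E) \<le> K1 * (K * E) / (M * E)"
          using K1 M E by (intro divide_right_mono mult_left_mono) auto
        also have "\<dots> = K1 * K / M" using E by simp
        finally have "h c \<le> K1 * K / M" using h(3)[OF c] by linarith
        then have "h c * k c \<le> K1 * K / M * k c"
          using q0[of c] by (intro mult_right_mono) (auto simp: k_eq)
        then show ?thesis using T0 by (simp add: indicator_def split: if_splits)
      next
        case False
        then have "?k0 * (K * E) \<le> ?k0 * (D c + 1 / c)"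
          using l by (intro mult_left_mono) auto
        then have "exp (- ?k0 * (D c + 1 / c)) \<le> exp (- ?k0 * K * E)"
          by (simp add: mult.assoc)
        then have "K0 * (a powr (- 1 - \<kappa>) * exp (- ?k0 * (D c + 1 / c))) \<le> T"
          unfolding T_def using K0 by (intro mult_left_mono) auto
        then have "q c \<le> T" using tail_bound[OF c] by linarith
        moreover have "h c * q c \<le> 1 * q c"
          using h(2)[OF c] q0[of c] by (intro mult_right_mono)
        moreover have "0 \<le> K1 * K / M * q c"
          using K1 K M q0[of c] by (intro mult_nonneg_nonneg divide_nonneg_nonneg) auto
        ultimately show ?thesis using c by (simp add: k_eq)
      qed
    qed (simp add: k_eq)
    then show "h c * (k c / ?Z) \<le> (K1 * K / M * k c + indicator {a..b} c * T) / ?Z"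
      using Z0 by (simp add: divide_right_mono)
  qed
  also have "\<dots> = (K1 * K / M * ?Z + (b - a) * T) / ?Z"
    using ab int_k int_ind[of a b] by (subst integral_divide_zero, subst Bochner_Integration.integral_add) auto
  also have "\<dots> = K1 * K / M + (b - a) * T / ?Z"
    using Z0 by (simp add: add_divide_distrib)
  also have "(b - a) * T / ?Z \<le> (b - a) * T / (cn * L)"
    using Z Z0 T0 ab cn0 L0 by (intro divide_left_mono) auto
  also have "(b - a) * T / (cn * L) = (b - a) * a powr (- 1 - \<kappa>) * exp (- ?k0 * K * E)
        / (cn * (2 * cn) powr (- 1 - \<kappa>) * exp (- K2 * E))"
    using K0 by (simp add: T_def L_def)
  finally show ?thesis by simp
qed

text \<open>The points where a continuous \<open>g\<close> exceeds \<delta> form a relatively open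
  set, which contains a rational as soon as it is nonempty. This makes the event below a countable
  union. The expression with \<open>- 0\<close> is the one produced by
  \<open>conv_in_prob\<close>.\<close>

lemma cSUP_le_on_Icc_iff:
  fixes g :: "real \<Rightarrow> real"
  assumes ab: "a < b" and cont: "continuous_on {a..b} g" and nonneg: "\<And>c. c \<in> {a..b} \<Longrightarrow> 0 \<le> g c"
  shows "\<delta> < \<bar>(SUP c\<in>{a..b}. g c) - 0\<bar> \<longleftrightarrow> (\<exists>c\<in>{a..b} \<inter> \<rat>. \<delta> < g c)"
    and "\<not> \<delta> < \<bar>(SUP c\<in>{a..b}. g c) - 0\<bar> \<Longrightarrow> c \<in> {a..b} \<Longrightarrow> g c \<le> \<delta>"
proof -
  have bdd: "bdd_above (g ` {a..b})"
    using compact_continuous_image[OF cont] by (auto intro: bounded_imp_bdd_above compact_imp_bounded)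
  have "0 \<le> (SUP c\<in>{a..b}. g c)"
    using ab nonneg[of a] by (intro cSUP_upper2[OF bdd, where x=a]) auto
  then have abs: "\<bar>(SUP c\<in>{a..b}. g c) - 0\<bar> = (SUP c\<in>{a..b}. g c)" by simp
  have iff: "\<delta> < (SUP c\<in>{a..b}. g c) \<longleftrightarrow> (\<exists>c\<in>{a..b}. \<delta> < g c)"
    using ab bdd by (intro less_cSUP_iff) auto
  show "\<not> \<delta> < \<bar>(SUP c\<in>{a..b}. g c) - 0\<bar> \<Longrightarrow> c \<in> {a..b} \<Longrightarrow> g c \<le> \<delta>"
    unfolding abs iff by force
  have "\<exists>c\<in>{a..b} \<inter> \<rat>. \<delta> < g c" if c: "c \<in> {a..b}" "\<delta> < g c" for c
  proof -
    have "openin (top_of_set {a..b}) ({a..b} \<inter> g -` {\<delta><..})"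
      by (rule continuous_openin_preimage_gen[OF cont]) simp
    then obtain T where T: "open T" "{a..b} \<inter> g -` {\<delta><..} = {a..b} \<inter> T"
      by (auto simp: openin_open)
    \<comment> \<open>The point \<open>c\<close> may be an end point, around which no ball fits into
      the interval; being in the closure of the open interval lets it be replaced by an interior
      point \<open>x\<close>.\<close>
    have "c \<in> closure {a<..<b}" using c(1) ab by simp
    moreover have "c \<in> {a..b} \<inter> T" using c unfolding T(2)[symmetric] by simp
    ultimately have "{a<..<b} \<inter> T \<noteq> {}"
      using open_Int_closure_eq_empty[OF T(1), of "{a<..<b}"] by blast
    then obtain x where "x \<in> {a<..<b} \<inter> T" by blast
    moreover have "open ({a<..<b} \<inter> T)" using T(1) by auto
    ultimately obtain d where d: "d > 0" "ball x d \<subseteq> {a<..<b} \<inter> T"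
      by (meson open_contains_ball)
    obtain q where q: "q \<in> \<rat>" "x < q" "q < x + d"
      using Rats_dense_in_real[of x "x + d"] d(1) by auto
    then have "q \<in> ball x d" by (auto simp: dist_real_def)
    then have "q \<in> {a<..<b} \<inter> T" using d by blast
    then have "q \<in> {a..b} \<inter> g -` {\<delta><..}" unfolding T(2) by auto
    then show ?thesis using q(1) by auto
  qed
  then show "\<delta> < \<bar>(SUP c\<in>{a..b}. g c) - 0\<bar> \<longleftrightarrow> (\<exists>c\<in>{a..b} \<inter> \<rat>. \<delta> < g c)"
    unfolding abs iff by blast
qed

text \<open>A limit statement about \<open>measure\<close> is informative only for measurable
  events, since others get the value 0. This lemma makes the hypotheses on the suprema of the
  remainders usable in a union bound.\<close>

lemma cSUP_event_measurable:
  fixes g :: "'w \<Rightarrow> real \<Rightarrow> real"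
  assumes ab: "a < b" and meas: "\<And>c. c \<in> {a..b} \<Longrightarrow> (\<lambda>\<omega>. g \<omega> c) \<in> borel_measurable N"
    and cont: "\<And>\<omega>. continuous_on {a..b} (g \<omega>)" and nonneg: "\<And>\<omega> c. c \<in> {a..b} \<Longrightarrow> 0 \<le> g \<omega> c"
  shows "{\<omega> \<in> space N. \<delta> < \<bar>(SUP c\<in>{a..b}. g \<omega> c) - 0\<bar>} \<in> sets N"
proof -
  have "\<delta> < \<bar>(SUP c\<in>{a..b}. g \<omega> c) - 0\<bar> \<longleftrightarrow> (\<exists>c\<in>{a..b} \<inter> \<rat>. \<delta> < g \<omega> c)" for \<omega>
    by (rule cSUP_le_on_Icc_iff(1)[OF ab cont nonneg])
  then have "{\<omega> \<in> space N. \<delta> < \<bar>(SUP c\<in>{a..b}. g \<omega> c) - 0\<bar>}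
      = (\<Union>c\<in>{a..b} \<inter> \<rat>. {\<omega> \<in> space N. \<delta> < g \<omega> c})"
    by (simp only:) blast
  also have "\<dots> \<in> sets N"
  proof (rule sets.countable_UN'')
    show "countable ({a..b} \<inter> \<rat> :: real set)"
      by (rule countable_subset[OF _ countable_rat]) blast
    show "{\<omega> \<in> space N. \<delta> < g \<omega> c} \<in> sets N" if "c \<in> {a..b} \<inter> \<rat>" for c
    proof -
      have [measurable]: "(\<lambda>\<omega>. g \<omega> c) \<in> borel_measurable N" using that meas by blast
      show ?thesis by measurable
    qed
  qed
  finally show ?thesis .
qed

text \<open>With \<open>N\<close> the sample size, the length of the range contributes at most
  \<open>N powr m\<close>, the prior at its left end \<open>N powr (1 + \<kappa>)\<close>, and the
  denominator \<open>N powr (m * \<kappa>)\<close>. \<open>K\<close> is chosen so that, after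
  cancelling \<open>exp (- K2 * E)\<close>, the exponential decays with one power more than these
  together; \<open>E \<ge> ln N\<close> then leaves \<open>1 / N\<close>.\<close>

lemma tail_ratio_bound:
  fixes N a b cn E m \<kappa> K2 k0 K :: real
  assumes N: "1 \<le> N" and ab: "1 / N \<le> a" "a \<le> b" "b \<le> N powr (m - 1)" and m: "1 \<le> m" and \<kappa>: "0 < \<kappa>"
    and cn: "a \<le> cn" "cn \<le> b" and E: "ln N \<le> E"
    and K: "k0 * K = m + 1 + \<kappa> + m * \<kappa> + K2 + 1"
  shows "(b - a) * a powr (- 1 - \<kappa>) * exp (- k0 * K * E)
      / (cn * (2 * cn) powr (- 1 - \<kappa>) * exp (- K2 * E)) \<le> 2 powr (1 + \<kappa>) / N"
proof -
  have N0: "0 < N" using N by simp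
  have a0: "0 < a" using ab(1) N0 by (meson less_le_trans zero_less_divide_1_iff)
  have cn0: "0 < cn" using a0 cn by simp
  let ?p = "m + 1 + \<kappa> + m * \<kappa>"
  have "N powr (m - 1) \<le> N powr m" using N by (intro powr_mono) auto
  then have bN: "b \<le> N powr m" using ab by linarith
  then have num1: "b - a \<le> N powr m" using a0 by linarith
  have "a powr (- 1 - \<kappa>) \<le> (1 / N) powr (- 1 - \<kappa>)"
    using ab N0 \<kappa> by (intro powr_mono2') auto
  also have "\<dots> = N powr (1 + \<kappa>)"
  proof -
    have "1 / N = N powr (- 1)" using N0 by (simp add: powr_minus_divide)
    then show ?thesis by (simp only: powr_powr) (simp add: add.commute)
  qed
  finally have num2: "a powr (- 1 - \<kappa>) \<le> N powr (1 + \<kappa>)" .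
  \<comment> \<open>The width \<open>cn\<close> times the prior bound is
    \<open>cn powr (- \<kappa>)\<close> up to a constant, so the worst case is the largest possible
    \<open>cn\<close>.\<close>
  have "(N powr m) powr (- \<kappa>) \<le> cn powr (- \<kappa>)"
    using cn bN cn0 \<kappa> by (intro powr_mono2') auto
  then have "2 powr (- 1 - \<kappa>) * N powr (- (m * \<kappa>)) \<le> 2 powr (- 1 - \<kappa>) * cn powr (- \<kappa>)"
    by (simp add: powr_powr)
  also have "\<dots> = cn * (2 * cn) powr (- 1 - \<kappa>)"
  proof -
    have "cn powr (- \<kappa>) = cn powr (1 + (- 1 - \<kappa>))" by simp
    also have "\<dots> = cn * cn powr (- 1 - \<kappa>)"
      unfolding powr_add using cn0 by simp
    finally show ?thesis using cn0 by (simp add: powr_mult)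
  qed
  finally have den: "2 powr (- 1 - \<kappa>) * N powr (- (m * \<kappa>)) \<le> cn * (2 * cn) powr (- 1 - \<kappa>)" .
  have "(b - a) * a powr (- 1 - \<kappa>) * exp (- k0 * K * E) / (cn * (2 * cn) powr (- 1 - \<kappa>) * exp (- K2 * E))
      \<le> N powr m * N powr (1 + \<kappa>) * exp (- k0 * K * E) / (2 powr (- 1 - \<kappa>) * N powr (- (m * \<kappa>)) * exp (- K2 * E))"
  proof (rule frac_le)
    show "(b - a) * a powr (- 1 - \<kappa>) * exp (- k0 * K * E) \<le> N powr m * N powr (1 + \<kappa>) * exp (- k0 * K * E)"
      using num1 num2 by (intro mult_right_mono mult_mono) auto
    show "2 powr (- 1 - \<kappa>) * N powr (- (m * \<kappa>)) * exp (- K2 * E) \<le> cn * (2 * cn) powr (- 1 - \<kappa>) * exp (- K2 * E)"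
      using den by (rule mult_right_mono) simp
  qed (use N0 in auto)
  also have "\<dots> = 2 powr (1 + \<kappa>) * (N powr ?p * exp (- (?p + 1) * E))"
  proof -
    have "exp (- k0 * K * E) = exp (- (?p + 1) * E) * exp (- K2 * E)"
      unfolding exp_add[symmetric] mult_minus_left K by (simp add: algebra_simps)
    moreover have "N powr ?p = N powr m * N powr (1 + \<kappa>) * N powr (m * \<kappa>)"
      by (simp add: add.assoc flip: powr_add)
    moreover have "N powr (- (m * \<kappa>)) = 1 / N powr (m * \<kappa>)" by (rule powr_minus_divide)
    moreover have "2 powr (- 1 - \<kappa>) = 1 / (2::real) powr (1 + \<kappa>)"
      using powr_minus_divide[of "2::real" "1 + \<kappa>"] by simp
    ultimately show ?thesis by simp
  qed
  also have "\<dots> \<le> 2 powr (1 + \<kappa>) * (N powr ?p * N powr (- (?p + 1)))"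
  proof -
    have "0 \<le> ?p + 1" using m \<kappa> by simp
    then have "(?p + 1) * ln N \<le> (?p + 1) * E" using E by (intro mult_left_mono)
    then have "exp (- (?p + 1) * E) \<le> N powr (- (?p + 1))"
      unfolding powr_def mult_minus_left using N0 by simp
    then show ?thesis by (intro mult_left_mono) auto
  qed
  also have "\<dots> = 2 powr (1 + \<kappa>) / N"
    using N0 by (simp flip: powr_add)
  finally show ?thesis .
qed

text \<open>This is \<open>ln y \<le> y - 1\<close> at \<open>y = 1 / (1 + x)\<close>.\<close>

lemma D2L_term_nonneg:
  fixes x :: real
  assumes "0 \<le> x"
  shows "0 \<le> ln (1 + x) - x / (1 + x)"
proof -
  have "ln (1 / (1 + x)) \<le> 1 / (1 + x) - 1"
    using assms by (intro ln_le_minus_one) auto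
  moreover have "1 / (1 + x) - 1 = - (x / (1 + x))" using assms by (simp add: field_simps)
  ultimately show ?thesis using assms by (simp add: ln_div)
qed

section \<open>Signs, monotonicity and continuity of the criteria, and the bound for a fixed noise
  vector\<close>

context spectral_covariance
begin

lemma D1L_nonneg: "0 \<le> c \<Longrightarrow> 0 \<le> D1L n ev g c"
  unfolding D1L_def by (intro sum_nonneg divide_nonneg_pos) (auto intro: one_plus_pos)

lemma D1L_antimono: "0 \<le> c \<Longrightarrow> c \<le> c' \<Longrightarrow> D1L n ev g c' \<le> D1L n ev g c"
  unfolding D1L_def
  by (intro sum_mono divide_left_mono mult_pos_pos add_left_mono mult_right_mono)
     (simp_all add: one_plus_pos ev_nonneg)

lemma D2L_nonneg: "0 \<le> c \<Longrightarrow> 0 \<le> D2L n ev c"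
  unfolding D2L_def by (intro sum_nonneg D2L_term_nonneg mult_nonneg_nonneg) (auto intro: ev_nonneg)

lemma s2_nonneg: "0 \<le> c \<Longrightarrow> 0 \<le> s2 n ev c"
  unfolding s2_def using one_plus_pos ev_nonneg
  by (intro sum_nonneg divide_nonneg_pos mult_nonneg_nonneg) auto

lemma continuous_on_criteria:
  assumes "A \<subseteq> {0..}"
  shows "continuous_on A (DL n ev g)" "continuous_on A (R1L n ev g z)" "continuous_on A (R2L n ev z)"
    "continuous_on A (R3 n ev g z)" "continuous_on A (R4 n ev z)"
proof -
  have ne: "\<forall>c\<in>A. 1 + c * ev j \<noteq> 0" if "j \<in> {..<n}" for j
    using one_plus_pos[of _ j] assms that by (auto simp: order_less_le)
  show "continuous_on A (DL n ev g)"
    unfolding DL_def D1L_def D2L_def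
  proof (intro continuous_on_add continuous_on_sum)
    fix j assume "j \<in> {..<n}"
    note ne = ne[OF this]
    have lin: "continuous_on A (\<lambda>c. c * ev j)" "continuous_on A (\<lambda>c. 1 + c * ev j)"
      by (intro continuous_intros)+
    show "continuous_on A (\<lambda>c. (g j)\<^sup>2 / (1 + c * ev j))"
      using ne by (intro continuous_on_divide lin continuous_on_const)
    show "continuous_on A (\<lambda>c. ln (1 + c * ev j) - c * ev j / (1 + c * ev j))"
      using ne by (intro continuous_on_diff continuous_on_divide continuous_on_ln lin)
  qed
  show "continuous_on A (R1L n ev g z)"
    unfolding R1L_def using ne
    by (intro continuous_on_add continuous_on_sum continuous_on_divide continuous_on_mult continuous_on_const continuous_on_id) auto
  show "continuous_on A (R2L n ev z)"
    unfolding R2L_def using ne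
    by (intro continuous_on_minus continuous_on_add continuous_on_sum continuous_on_divide continuous_on_mult continuous_on_const continuous_on_id) auto
  show "continuous_on A (R3 n ev g z)"
    unfolding R3_def using ne
    by (intro continuous_on_add continuous_on_sum continuous_on_divide continuous_on_mult continuous_on_power continuous_on_const continuous_on_id) auto
  show "continuous_on A (R4 n ev z)"
    unfolding R4_def using ne
    by (intro continuous_on_add continuous_on_sum continuous_on_divide continuous_on_mult continuous_on_power continuous_on_const continuous_on_id) auto
qed

text \<open>A deterministic statement for one \<open>n\<close> and one noise vector with small
  remainders. \<open>K1\<close> collects the Markov bound relative to \<open>G\<close>: 1 for
  \<open>D1L\<close>, 1/2 for \<open>R3\<close> and \<open>R4\<close>, \<open>C\<close> for
  \<open>D2R\<close> and \<open>1 / C1\<close> for \<open>s2\<close>. \<open>q\<close> is the growth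
  factor of the criterion between \<open>cn\<close> and \<open>2 * cn\<close>, and \<open>K\<close>
  solves the equation in \<open>tail_ratio_bound\<close>.\<close>

lemma hier_posterior_bound:
  fixes m \<kappa> l B b C C1 M cn :: real and g z :: "real Matrix.vec"
  defines "G \<equiv> DL n ev (coords e g)" and "q \<equiv> max 1 (2 powr b / B)"
  defines "K1 \<equiv> 3 / 2 + C + 1 / C1" and "K2 \<equiv> q * max 1 (2 * l)"
  defines "K \<equiv> (m + 1 + \<kappa> + m * \<kappa> + K2 + 1) / min (1 / 4) l"
  assumes n: "3 \<le> n" and m: "1 \<le> m" and \<kappa>: "0 < \<kappa>" and l: "0 < l"
    and g: "g \<in> carrier_vec n" and z: "z \<in> carrier_vec n"
    and b: "0 < b" and B: "0 < B"
    and good: "\<And>c k. c \<in> c_range m n \<Longrightarrow> 0 < k \<Longrightarrow> k < 1 \<Longrightarrow> k * c \<in> c_range m n \<Longrightarrow>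
        B * k powr b * D2L n ev c \<le> D2L n ev (k * c)"
    and log_le: "\<And>c. c \<in> c_range m n \<Longrightarrow> ln (real n * c) \<le> D2L n ev c"
    and cn_min: "is_arg_min (\<lambda>c. G c + 2 * l / c) (\<lambda>c. 0 < c) cn"
    and cn: "cn \<in> c_range m n" "2 * cn \<in> c_range m n"
    and D2R_le: "\<And>c. c \<in> c_range m n \<Longrightarrow> D2R n ev c \<le> C * D2L n ev c"
    and s2_le: "\<And>c. c \<in> c_range m n \<Longrightarrow> s2 n ev c \<le> D2L n ev c / C1"
    and C: "0 < C" and C1: "0 < C1"
    and R12: "\<And>c. c \<in> c_range m n \<Longrightarrow>
        \<bar>R1L n ev (coords e g) (coords e z) c\<bar> + \<bar>R2L n ev (coords e z) c\<bar> \<le> G c / 2"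
    and R34: "\<And>c. c \<in> c_range m n \<Longrightarrow>
        \<bar>R3 n ev (coords e g) (coords e z) c\<bar> + \<bar>R4 n ev (coords e z) c\<bar> \<le> G c / 2"
    and M: "0 < M"
  shows "\<bar>hier_posterior (prior_kernel \<kappa> l (c_range m n)) U (g + z)
      {w \<in> carrier_vec n. sq_norm_v (w - g) \<ge> M * (INF c\<in>c_range m n. G c + 1 / c)}\<bar>
    \<le> K1 * K / M + 2 powr (1 + \<kappa>) / real n"
proof -
  let ?I = "c_range m n" and ?g = "coords e g" and ?z = "coords e z"
  define lo hi where "lo = ln (real n) / real n" and "hi = real n powr (m - 1)"
  define E where "E = (INF c\<in>?I. G c + 1 / c)"
  let ?B = "{w \<in> carrier_vec n. sq_norm_v (w - g) \<ge> M * E}"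
  have I: "?I = {lo..hi}" by (simp add: c_range_def lo_def hi_def)
  \<comment> \<open>From \<open>3 \<le> n\<close> follows \<open>ln n \<ge> 1\<close>, which puts
    the left end of the range at or above \<open>1 / n\<close> and later makes \<open>E\<close>
    positive.\<close>
  have "exp 1 \<le> real n" using exp_le n by linarith
  then have ln_n: "1 \<le> ln (real n)" using n by (subst ln_ge_iff) auto
  then have lo_n: "1 / real n \<le> lo" using n by (simp add: lo_def divide_right_mono)
  have lo0: "0 < lo" using ln_n n by (simp add: lo_def)
  have lo_hi: "lo \<le> hi" using cn by (simp add: I)
  have pos: "0 < c" if "c \<in> ?I" for c using that lo0 by (simp add: I)
  have G_ge: "D2L n ev c \<le> G c" "0 \<le> G c" if "0 < c" for c
    using D1L_nonneg[of c ?g] D2L_nonneg[of c] that by (auto simp: G_def DL_def)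
  have E_le: "x \<le> E" if "\<And>c. c \<in> ?I \<Longrightarrow> x \<le> G c + 1 / c" for x
    unfolding E_def using that cn by (intro cINF_greatest) auto
  text \<open>Since \<open>ln c + 1 / c \<ge> 1\<close>, polynomial factors in \<open>n\<close> are absorbed into \<open>exp E\<close>.\<close>
  have ln_E: "ln (real n) \<le> E"
  proof (rule E_le)
    fix c assume c: "c \<in> ?I"
    have "ln (1 / c) \<le> 1 / c - 1" using pos[OF c] by (intro ln_le_minus_one) simp
    then have "ln (real n) \<le> ln (real n * c) + 1 / c"
      using pos[OF c] n by (simp add: ln_mult ln_div)
    then show "ln (real n) \<le> G c + 1 / c"
      using log_le[OF c] G_ge(1)[OF pos[OF c]] by linarith
  qed
  then have E0: "0 < E" using ln_n by linarith
  have cn0: "0 < cn" using cn pos by blast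
  have le_mult: "x \<le> p * x" if "1 \<le> p" "0 \<le> x" for p x :: real
    using mult_right_mono[OF that] by simp
  have q1: "1 \<le> q" by (simp add: q_def)
  have K2_nonneg: "0 \<le> K2" using q1 by (simp add: K2_def)
  \<comment> \<open>Minimality compares \<open>cn\<close> with every \<open>c\<close> in the range;
    each summand of \<open>G c + 2 * l / c\<close> is at most \<open>max 1 (2 * l)\<close> times its
    counterpart in \<open>G c + 1 / c\<close>.\<close>
  have "(G cn + 2 * l / cn) / max 1 (2 * l) \<le> E"
  proof (rule E_le)
    fix c assume c: "c \<in> ?I"
    have "G cn + 2 * l / cn \<le> G c + 2 * l * (1 / c)"
    proof -
      have "\<not> (0 < c \<and> G c + 2 * l / c < G cn + 2 * l / cn)"
        using cn_min by (simp add: is_arg_min_def)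
      then show ?thesis using pos[OF c] by simp
    qed
    also have "\<dots> \<le> max 1 (2 * l) * G c + max 1 (2 * l) * (1 / c)"
      using G_ge(2)[OF pos[OF c]] pos[OF c] by (intro add_mono le_mult mult_right_mono) auto
    finally show "(G cn + 2 * l / cn) / max 1 (2 * l) \<le> G c + 1 / c"
      by (simp add: pos_divide_le_eq less_max_iff_disj distrib_right mult.commute)
  qed
  then have G_cn: "q * (G cn + 2 * l / cn) \<le> K2 * E"
    using q1 by (simp add: pos_divide_le_eq less_max_iff_disj K2_def mult.assoc mult.commute[of E])
  \<comment> \<open>Moving right from \<open>cn\<close> decreases \<open>D1L\<close> and
    \<open>2 * l / c\<close>. Good variance with the ratio \<open>k = cn / c\<close>, at least 1/2,
    controls \<open>D2L\<close>. Taking \<open>q \<ge> 1\<close> lets one factor cover all three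
    terms.\<close>
  have K2: "G c + 2 * l / c \<le> K2 * E" if c: "c \<in> {cn..2 * cn}" for c
  proof -
    have cI: "c \<in> ?I" and c0: "0 < c" using c cn cn0 by (auto simp: I)
    have D1: "D1L n ev ?g c \<le> q * D1L n ev ?g cn"
      using D1L_antimono[of cn c ?g] le_mult[OF q1 D1L_nonneg[of cn ?g]] c cn0 by auto
    have D2: "D2L n ev c \<le> q * D2L n ev cn"
    \<comment> \<open>Good variance speaks only of ratios strictly below 1, so the left end point is
      treated separately.\<close>
    proof (cases "c = cn")
      case True
      then show ?thesis
        using le_mult[OF q1 D2L_nonneg[of cn]] cn0 by simp
    next
      case False
      define k where "k = cn / c"
      have k: "1 / 2 \<le> k" "k < 1" "k * c = cn"
        using False c c0 by (auto simp: k_def field_simps)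
      have "(1 / 2) powr b \<le> k powr b" using k b by (intro powr_mono2) auto
      then have "B * (1 / 2) powr b * D2L n ev c \<le> B * k powr b * D2L n ev c"
        using B D2L_nonneg[of c] c0 by (intro mult_right_mono mult_left_mono) auto
      also have "\<dots> \<le> D2L n ev cn"
        using good[OF cI _ k(2)] k cn by auto
      finally have "D2L n ev c \<le> 2 powr b / B * D2L n ev cn"
        using B by (simp add: powr_divide field_simps)
      also have "\<dots> \<le> q * D2L n ev cn"
        using D2L_nonneg[of cn] cn0 by (intro mult_right_mono) (auto simp: q_def)
      finally show ?thesis .
    qed
    have "2 * l / c \<le> 2 * l / cn" using c cn0 l by (intro divide_left_mono) auto
    also have "\<dots> \<le> q * (2 * l / cn)"
      using l cn0 by (intro le_mult q1) simp
    finally have "G c + 2 * l / c \<le> q * (G cn + 2 * l / cn)"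
      using D1 D2 by (simp add: G_def DL_def distrib_left)
    then show ?thesis using G_cn by linarith
  qed
  have k0: "0 < min (1 / 4) l" using l by simp
  have K0: "0 \<le> K" using m \<kappa> K2_nonneg k0 by (simp add: K_def)
  have K1: "0 \<le> K1" using C C1 by (simp add: K1_def)
  have h: "measure (cond_posterior U (g + z) c) ?B \<le> K1 * G c / (M * E)" if c: "c \<in> ?I" for c
  proof -
    have D2L: "0 \<le> D2L n ev c" "D2L n ev c \<le> G c"
      using D2L_nonneg[of c] pos[OF c] G_ge by auto
    have "C * D2L n ev c \<le> C * G c" "D2L n ev c / C1 \<le> G c / C1"
      using D2L C C1 by (auto intro: mult_left_mono divide_right_mono)
    moreover have "D1L n ev ?g c \<le> G c" using D2L by (simp add: G_def DL_def)
    ultimately have "D1L n ev ?g c + R3 n ev ?g ?z c + D2R n ev c + R4 n ev ?z c + s2 n ev c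
        \<le> G c + G c / 2 + C * G c + G c / C1"
      using R34[OF c] D2R_le[OF c] s2_le[OF c] by linarith
    also have "\<dots> = K1 * G c" by (simp add: K1_def algebra_simps)
    finally show ?thesis
      using cond_posterior_markov[OF _ g z, of c "M * E"] pos[OF c] M E0
      by (meson divide_right_mono less_imp_le mult_pos_pos order_trans)
  qed
  have "\<bar>hier_posterior (prior_kernel \<kappa> l ?I) U (g + z) ?B\<bar>
    \<le> K1 * K / M + (hi - lo) * lo powr (- 1 - \<kappa>) * exp (- min (1 / 4) l * K * E)
        / (cn * (2 * cn) powr (- 1 - \<kappa>) * exp (- K2 * E))"
    unfolding hier_posterior_def post_density_def
  proof (rule hierarchical_integral_bound[where D=G and h="\<lambda>c. measure (cond_posterior U (g + z) c) ?B"
        and k="post_kernel (prior_kernel \<kappa> l ?I) U (g + z)" and E=E and ?K1.0=K1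
        and R="\<lambda>c. R1L n ev ?g ?z c + R2L n ev ?z c" and ?K0.0="exp (- (\<Sum>j<n. (?z j)\<^sup>2) / 2)"])
    show "post_kernel (prior_kernel \<kappa> l ?I) U (g + z) c = exp (- (\<Sum>j<n. (?z j)\<^sup>2) / 2)
        * exp (- (G c + (R1L n ev ?g ?z c + R2L n ev ?z c)) / 2) * prior_kernel \<kappa> l {lo..hi} c"
      if "0 \<le> c" for c
      using post_kernel_spectral[OF that g z] by (simp add: I G_def)
    show "post_kernel (prior_kernel \<kappa> l ?I) U (g + z) c = 0" if "c < 0" for c
      using that lo0 by (simp add: post_kernel_def prior_kernel_def I)
    show "continuous_on {lo..hi} (\<lambda>c. G c + (R1L n ev ?g ?z c + R2L n ev ?z c))"
      unfolding G_def using lo0 by (intro continuous_on_add continuous_on_criteria) auto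
    show "\<bar>R1L n ev ?g ?z c + R2L n ev ?z c\<bar> \<le> G c / 2" if "c \<in> {lo..hi}" for c
      using order_trans[OF abs_triangle_ineq R12[of c]] that by (simp add: I)
    show "measure (cond_posterior U (g + z) c) ?B \<le> 1" if "c \<in> {lo..hi}" for c
      using prob_space.prob_le_1[OF prob_space_cond_posterior[of c "g + z"]] that lo0 g z by simp
    show "measure (cond_posterior U (g + z) c) ?B \<le> K1 * G c / (M * E)" if "c \<in> {lo..hi}" for c
      using h that by (simp add: I)
    show "0 \<le> G c" if "c \<in> {lo..hi}" for c
      using G_ge(2) that lo0 by auto
    show "G c + 2 * l / c \<le> K2 * E" if "c \<in> {cn..2 * cn}" for c
      using K2 that .
  qed (use lo0 lo_hi \<kappa> l K1 K0 M E0 cn in \<open>auto simp: I\<close>)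
  also have "(hi - lo) * lo powr (- 1 - \<kappa>) * exp (- min (1 / 4) l * K * E)
        / (cn * (2 * cn) powr (- 1 - \<kappa>) * exp (- K2 * E)) \<le> 2 powr (1 + \<kappa>) / real n"
  proof (rule tail_ratio_bound[where m=m])
    show "min (1 / 4) l * K = m + 1 + \<kappa> + m * \<kappa> + K2 + 1"
      using k0 by (simp add: K_def)
  qed (use n lo_n lo_hi m \<kappa> cn ln_E in \<open>auto simp: I hi_def\<close>)
  finally show ?thesis by (simp add: E_def)
qed

end

section \<open>Convergence in probability\<close>

text \<open>A set \<open>S\<close> that is not measurable has measure 0.\<close>
lemma measure_subset_union_le:
  assumes "prob_space N" "A \<in> sets N" "B \<in> sets N" "S \<subseteq> A \<union> B"
  shows "measure N S \<le> measure N A + measure N B"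
proof -
  interpret prob_space N by fact
  have "measure N S \<le> measure N (A \<union> B)"
    using assms by (cases "S \<in> sets N") (auto intro: finite_measure_mono simp: measure_notin_sets)
  also have "\<dots> \<le> measure N A + measure N B"
    using assms by (intro measure_subadditive) (auto simp: emeasure_eq_measure)
  finally show ?thesis .
qed

context spectral_covariance
begin

lemma measurable_coords:
  assumes "X \<in> measurable N (vec_borel n)" "j < n"
  shows "(\<lambda>\<omega>. coords e (X \<omega>) j) \<in> borel_measurable N"
proof -
  have "(\<lambda>\<omega>. \<Sum>i<n. vec_index (X \<omega>) i * vec_index (e j) i) \<in> borel_measurable N"
    using measurable_compose[OF assms(1) measurable_vec_index]
    by (intro borel_measurable_sum borel_measurable_times) auto
  then show ?thesis
    using basis_carrier[OF assms(2)] by (simp add: coords_def scalar_prod_def atLeast0LessThan)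
qed

lemma measurable_remainders:
  assumes "\<And>j. j < n \<Longrightarrow> (\<lambda>\<omega>. z \<omega> j) \<in> borel_measurable N"
  shows "(\<lambda>\<omega>. R1L n ev g (z \<omega>) c) \<in> borel_measurable N"
    "(\<lambda>\<omega>. R2L n ev (z \<omega>) c) \<in> borel_measurable N"
    "(\<lambda>\<omega>. R3 n ev g (z \<omega>) c) \<in> borel_measurable N"
    "(\<lambda>\<omega>. R4 n ev (z \<omega>) c) \<in> borel_measurable N"
  unfolding R1L_def R2L_def R3_def R4_def
  by (intro borel_measurable_times borel_measurable_uminus borel_measurable_sum borel_measurable_divide
      borel_measurable_diff borel_measurable_power borel_measurable_const assms; simp)+

end

theorem theorem28:
  fixes x :: "nat \<Rightarrow> nat \<Rightarrow> 'x"
    and W :: "'x \<Rightarrow> 'p \<Rightarrow> real" and MW :: "'p measure"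
    and U :: "nat \<Rightarrow> real Matrix.mat"
    and e :: "nat \<Rightarrow> nat \<Rightarrow> real Matrix.vec" and ev :: "nat \<Rightarrow> nat \<Rightarrow> real"
    and f :: "'x \<Rightarrow> real"
    and P :: "nat \<Rightarrow> 'w measure"
    and \<epsilon> Y :: "nat \<Rightarrow> 'w \<Rightarrow> real Matrix.vec"
    and fv :: "nat \<Rightarrow> real Matrix.vec" and fc :: "nat \<Rightarrow> nat \<Rightarrow> real"
    and Z :: "nat \<Rightarrow> 'w \<Rightarrow> nat \<Rightarrow> real"
    and m \<kappa> l :: real and M :: "nat \<Rightarrow> real"
  assumes "1 \<le> m" and "0 < \<kappa>" and "0 < l"
    and W: "centered_gaussian_process MW W"
    and U: "\<And>n. U n = cov_mat MW W (x n) n"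
    and e: "\<And>n. 1 \<le> n \<Longrightarrow> orthonormal_eigenbasis (U n) (e n) (ev n)"
    and fv: "\<And>n. fv n = design_vec x f n"
    and P: "\<And>n. 1 \<le> n \<Longrightarrow> prob_space (P n)"
    and \<epsilon>: "\<And>n. 1 \<le> n \<Longrightarrow> has_mv_normal_law (P n) (\<epsilon> n) (0\<^sub>v n) (1\<^sub>m n)"
    and Y: "\<And>n \<omega>. Y n \<omega> = fv n + \<epsilon> n \<omega>"
    and fc: "\<And>n. fc n = coords (e n) (fv n)"
    and Z: "\<And>n \<omega>. Z n \<omega> = coords (e n) (\<epsilon> n \<omega>)"
    and a1: "conv_in_prob P (\<lambda>n \<omega>. SUP c\<in>c_range m n.
          (\<bar>R1L n (ev n) (fc n) (Z n \<omega>) c\<bar> + \<bar>R2L n (ev n) (Z n \<omega>) c\<bar>)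
            / DL n (ev n) (fc n) c) 0"
    and a2: "conv_in_prob P (\<lambda>n \<omega>. SUP c\<in>c_range m n.
          (\<bar>R3 n (ev n) (fc n) (Z n \<omega>) c\<bar> + \<bar>R4 n (ev n) (Z n \<omega>) c\<bar>)
            / DL n (ev n) (fc n) c) 0"
    and b1: "good_variance_function (c_range m) (\<lambda>n. D2L n (ev n))"
    and b2: "\<forall>\<^sub>F n in sequentially. \<forall>c\<in>c_range m n. ln (real n * c) \<le> D2L n (ev n) c"
    and c: "\<forall>\<^sub>F n in sequentially. \<exists>cn.
          is_arg_min (\<lambda>c. DL n (ev n) (fc n) c + 2 * l / c) (\<lambda>c. 0 < c) cn \<and>
          cn \<in> c_range m n \<and> 2 * cn \<in> c_range m n"
    and d1: "uniformly_asymp (c_range m) (\<lambda>n. D2R n (ev n)) (\<lambda>n. D2L n (ev n))"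
    and d2: "uniformly_asymp (c_range m) (\<lambda>n. D2L n (ev n)) (\<lambda>n. s2 n (ev n))"
    and M: "filterlim M at_top sequentially"
  shows "conv_in_prob P (\<lambda>n \<omega>.
           hier_posterior (prior_kernel \<kappa> l (c_range m n)) (U n) (Y n \<omega>)
             {w \<in> carrier_vec n. sq_norm_v (w - fv n)
                \<ge> M n * (INF c\<in>c_range m n. DL n (ev n) (fc n) c + 1 / c)}) 0"
proof -
  obtain b B B' where b: "0 < b" "0 < B" and *: "\<forall>\<^sub>F n in sequentially. \<forall>c\<in>c_range m n.
      \<forall>k\<in>{0<..<1}. k * c \<in> c_range m n \<longrightarrow> B * k powr b * D2L n (ev n) c \<le> D2L n (ev n) (k * c)
        \<and> D2L n (ev n) (k * c) \<le> B' * k powr b * D2L n (ev n) c"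
    using b1 unfolding good_variance_function_def by blast
  from * have ev_good: "\<forall>\<^sub>F n in sequentially. \<forall>c\<in>c_range m n.
      \<forall>k\<in>{0<..<1}. k * c \<in> c_range m n \<longrightarrow> B * k powr b * D2L n (ev n) c \<le> D2L n (ev n) (k * c)"
    by (rule eventually_mono) blast
  obtain C' C where C: "0 < C" and *: "\<forall>\<^sub>F n in sequentially. \<forall>c\<in>c_range m n.
      C' \<le> D2R n (ev n) c / D2L n (ev n) c \<and> D2R n (ev n) c / D2L n (ev n) c \<le> C"
    using d1 unfolding uniformly_asymp_def by blast
  from * have ev_C: "\<forall>\<^sub>F n in sequentially. \<forall>c\<in>c_range m n. D2R n (ev n) c / D2L n (ev n) c \<le> C"
    by (rule eventually_mono) blast
  obtain C1 C2 where C1: "0 < C1" and *: "\<forall>\<^sub>F n in sequentially. \<forall>c\<in>c_range m n.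
      C1 \<le> D2L n (ev n) c / s2 n (ev n) c \<and> D2L n (ev n) c / s2 n (ev n) c \<le> C2"
    using d2 unfolding uniformly_asymp_def by blast
  from * have ev_C1: "\<forall>\<^sub>F n in sequentially. \<forall>c\<in>c_range m n. C1 \<le> D2L n (ev n) c / s2 n (ev n) c"
    by (rule eventually_mono) blast
  define K1 where "K1 = 3 / 2 + C + 1 / C1"
  define K2 where "K2 = max 1 (2 powr b / B) * max 1 (2 * l)"
  define K where "K = (m + 1 + \<kappa> + m * \<kappa> + K2 + 1) / min (1 / 4) l"
  let ?bound = "\<lambda>n. K1 * K / M n + 2 powr (1 + \<kappa>) / real n"
  define X where "X n \<omega> = hier_posterior (prior_kernel \<kappa> l (c_range m n)) (U n) (Y n \<omega>)
      {w \<in> carrier_vec n. sq_norm_v (w - fv n)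
        \<ge> M n * (INF c\<in>c_range m n. DL n (ev n) (fc n) c + 1 / c)}" for n \<omega>
  define S12 where "S12 n \<omega> c = (\<bar>R1L n (ev n) (fc n) (Z n \<omega>) c\<bar> + \<bar>R2L n (ev n) (Z n \<omega>) c\<bar>)
            / DL n (ev n) (fc n) c" for n \<omega> c
  define S34 where "S34 n \<omega> c = (\<bar>R3 n (ev n) (fc n) (Z n \<omega>) c\<bar> + \<bar>R4 n (ev n) (Z n \<omega>) c\<bar>)
            / DL n (ev n) (fc n) c" for n \<omega> c
  \<comment> \<open>The threshold 1/2 leaves half of \<open>DL\<close> in the likelihood exponent,
    as \<open>hier_posterior_bound\<close> demands.\<close>
  define A12 where "A12 n = {\<omega> \<in> space (P n). 1 / 2 < \<bar>(SUP c\<in>c_range m n. S12 n \<omega> c) - 0\<bar>}" for n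
  define A34 where "A34 n = {\<omega> \<in> space (P n). 1 / 2 < \<bar>(SUP c\<in>c_range m n. S34 n \<omega> c) - 0\<bar>}" for n
  have A_lim: "(\<lambda>n. measure (P n) (A12 n)) \<longlonglongrightarrow> 0" "(\<lambda>n. measure (P n) (A34 n)) \<longlonglongrightarrow> 0"
    using a1[unfolded conv_in_prob_def, rule_format, of "1 / 2"]
      a2[unfolded conv_in_prob_def, rule_format, of "1 / 2"]
    by (simp_all add: A12_def A34_def S12_def S34_def)
  have bound_lim: "?bound \<longlonglongrightarrow> 0"
  proof -
    have "(\<lambda>n. K1 * K / M n) \<longlonglongrightarrow> 0"
      by (intro tendsto_divide_0[OF tendsto_const] filterlim_at_top_imp_at_infinity M)
    moreover have "(\<lambda>n. 2 powr (1 + \<kappa>) / real n) \<longlonglongrightarrow> 0"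
      by (rule lim_const_over_n)
    ultimately show ?thesis using tendsto_add by fastforce
  qed
  \<comment> \<open>At an \<open>n\<close> where all eventual conditions hold, the randomness is
    confined to two measurable events; off them the bound is deterministic and tends to 0.\<close>
  have main: "A12 n \<in> sets (P n) \<and> A34 n \<in> sets (P n) \<and>
      (\<forall>\<omega>\<in>space (P n) - (A12 n \<union> A34 n). \<bar>X n \<omega>\<bar> \<le> ?bound n)"
    if n: "3 \<le> n" and Mn: "0 < M n"
      and good: "\<forall>c\<in>c_range m n.
        \<forall>k\<in>{0<..<1}. k * c \<in> c_range m n \<longrightarrow> B * k powr b * D2L n (ev n) c \<le> D2L n (ev n) (k * c)"
      and CC: "\<forall>c\<in>c_range m n. D2R n (ev n) c / D2L n (ev n) c \<le> C"
      and CC1: "\<forall>c\<in>c_range m n. C1 \<le> D2L n (ev n) c / s2 n (ev n) c"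
      and log_le: "\<forall>c\<in>c_range m n. ln (real n * c) \<le> D2L n (ev n) c"
      and cn: "is_arg_min (\<lambda>c. DL n (ev n) (fc n) c + 2 * l / c) (\<lambda>c. 0 < c) cn"
        "cn \<in> c_range m n" "2 * cn \<in> c_range m n" for n cn
  proof -
    have n1: "1 \<le> n" using n by simp
    have U_carrier: "U n \<in> carrier_mat n n" by (simp add: U cov_mat_def)
    have basis: "\<And>j. j < n \<Longrightarrow> e n j \<in> carrier_vec n" "\<And>j. j < n \<Longrightarrow> U n *\<^sub>v e n j = ev n j \<cdot>\<^sub>v e n j"
      "\<And>i j. i < n \<Longrightarrow> j < n \<Longrightarrow> scalar_prod (e n i) (e n j) = (if i = j then 1 else 0)"
      using e[OF n1] carrier_matD[OF U_carrier] by (simp_all add: orthonormal_eigenbasis_def)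
    interpret spectral_covariance n "e n" "U n" "ev n"
    proof
      show "0 \<le> ev n j" if "j < n" for j
        using basis[OF that] basis(3)[OF that that]
        by (intro cov_mat_eigenvalue_nonneg[OF W, where v="e n j" and n=n and t="x n"]) (auto simp: U)
    qed (use basis U_carrier in auto)
    have g: "fv n \<in> carrier_vec n" by (simp add: fv design_vec_def)
    have eps: "\<epsilon> n \<in> measurable (P n) (vec_borel n)"
      using \<epsilon>[OF n1] by (simp add: has_mv_normal_law_def)
    have Z_meas: "(\<lambda>\<omega>. Z n \<omega> j) \<in> borel_measurable (P n)" if "j < n" for j
      unfolding Z by (rule measurable_coords[OF eps that])
    obtain lo hi where I: "c_range m n = {lo..hi}" and lo: "0 < lo"
      by (rule that[of "ln (real n) / real n" "real n powr (m - 1)"]) (use n in \<open>simp_all add: c_range_def\<close>)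
    \<comment> \<open>Both \<open>cn\<close> and \<open>2 * cn\<close> lie in the range and differ,
      so the interval is nondegenerate, as the argument with rational points requires.\<close>
    have lohi: "lo < hi" using cn lo by (auto simp: I)
    have pos: "0 < c" if "c \<in> c_range m n" for c using that lo by (simp add: I)
    \<comment> \<open>Since division by zero gives 0, the positive lower bound \<open>C1\<close> on
      the ratio forces numerator and denominator to be nonzero. Only then can the ratio bounds be
      multiplied out.\<close>
    have D2L_pos: "0 < D2L n (ev n) c" "0 < s2 n (ev n) c" if "c \<in> c_range m n" for c
    proof -
      have "0 < D2L n (ev n) c / s2 n (ev n) c" using CC1 C1 that by (meson less_le_trans)
      then show "0 < D2L n (ev n) c" "0 < s2 n (ev n) c"
        using D2L_nonneg[of c] s2_nonneg[of c] pos[OF that] by (auto simp: zero_less_divide_iff)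
    qed
    have DL_pos: "0 < DL n (ev n) (fc n) c" if "c \<in> c_range m n" for c
      using D1L_nonneg[of c "fc n"] D2L_pos(1)[OF that] pos[OF that] by (simp add: DL_def)
    have cont: "continuous_on {lo..hi} (S12 n \<omega>)" "continuous_on {lo..hi} (S34 n \<omega>)" for \<omega>
      unfolding S12_def S34_def using DL_pos lo
      by (intro continuous_on_divide continuous_on_add continuous_on_rabs continuous_on_criteria;
          force simp: I)+
    have nonneg: "0 \<le> S12 n \<omega> c" "0 \<le> S34 n \<omega> c" if "c \<in> {lo..hi}" for \<omega> c
      using DL_pos[of c] that by (simp_all add: S12_def S34_def I)
    have S_meas: "(\<lambda>\<omega>. S12 n \<omega> c) \<in> borel_measurable (P n)" "(\<lambda>\<omega>. S34 n \<omega> c) \<in> borel_measurable (P n)" for c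
      unfolding S12_def S34_def
      by (intro borel_measurable_divide borel_measurable_add borel_measurable_abs
          measurable_remainders Z_meas borel_measurable_const; assumption)+
    have sets: "A12 n \<in> sets (P n)" "A34 n \<in> sets (P n)"
      unfolding A12_def A34_def I
      by (intro cSUP_event_measurable[OF lohi] S_meas cont nonneg; assumption)+
    have "\<bar>X n \<omega>\<bar> \<le> ?bound n" if \<omega>: "\<omega> \<in> space (P n)" "\<omega> \<notin> A12 n" "\<omega> \<notin> A34 n" for \<omega>
    proof -
      have z: "\<epsilon> n \<omega> \<in> carrier_vec n" using measurable_space[OF eps \<omega>(1)] by simp
      have S: "S12 n \<omega> c \<le> 1 / 2" "S34 n \<omega> c \<le> 1 / 2" if "c \<in> c_range m n" for c
        using cSUP_le_on_Icc_iff(2)[OF lohi cont(1) nonneg(1), of "1 / 2" \<omega> c]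
          cSUP_le_on_Icc_iff(2)[OF lohi cont(2) nonneg(2), of "1 / 2" \<omega> c] \<omega> that
        by (simp_all add: A12_def A34_def I)
      show ?thesis
        unfolding X_def Y fc K_def K2_def K1_def
      proof (rule hier_posterior_bound[where cn=cn and b=b and B=B and C=C and ?C1.0=C1])
        show "is_arg_min (\<lambda>c. DL n (ev n) (coords (e n) (fv n)) c + 2 * l / c) (\<lambda>c. 0 < c) cn"
          using cn(1) by (simp add: fc)
        fix c assume c: "c \<in> c_range m n"
        show "D2R n (ev n) c \<le> C * D2L n (ev n) c"
          using bspec[OF CC c] D2L_pos(1)[OF c] by (simp add: pos_divide_le_eq)
        show "s2 n (ev n) c \<le> D2L n (ev n) c / C1"
          using bspec[OF CC1 c] D2L_pos(2)[OF c] C1 by (simp add: pos_le_divide_eq mult.commute)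
        show "\<bar>R1L n (ev n) (coords (e n) (fv n)) (coords (e n) (\<epsilon> n \<omega>)) c\<bar>
            + \<bar>R2L n (ev n) (coords (e n) (\<epsilon> n \<omega>)) c\<bar> \<le> DL n (ev n) (coords (e n) (fv n)) c / 2"
          "\<bar>R3 n (ev n) (coords (e n) (fv n)) (coords (e n) (\<epsilon> n \<omega>)) c\<bar>
            + \<bar>R4 n (ev n) (coords (e n) (\<epsilon> n \<omega>)) c\<bar> \<le> DL n (ev n) (coords (e n) (fv n)) c / 2"
          using S[OF c] DL_pos[OF c] by (simp_all add: S12_def S34_def fc Z pos_divide_le_eq)
      qed (use n assms(1-3) g z b good log_le cn C C1 Mn in auto)
    qed
    then show ?thesis using sets by blast
  qed
  have ev_main: "\<forall>\<^sub>F n in sequentially. 3 \<le> n \<and> A12 n \<in> sets (P n) \<and> A34 n \<in> sets (P n) \<and>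
      (\<forall>\<omega>\<in>space (P n) - (A12 n \<union> A34 n). \<bar>X n \<omega>\<bar> \<le> ?bound n)"
    using eventually_ge_at_top[of 3] M[unfolded filterlim_at_top_dense, rule_format, of 0]
      ev_good ev_C ev_C1 b2 c
  proof eventually_elim
    case (elim n)
    then show ?case using main[of n] by blast
  qed
  show ?thesis
    unfolding conv_in_prob_def X_def[symmetric]
  proof (intro allI impI)
    fix \<delta> :: real assume "0 < \<delta>"
    show "(\<lambda>n. measure (P n) {\<omega> \<in> space (P n). \<delta> < \<bar>X n \<omega> - 0\<bar>}) \<longlonglongrightarrow> 0"
    proof (rule tendsto_sandwich[where f="\<lambda>_. 0"])
      show "(\<lambda>n. measure (P n) (A12 n) + measure (P n) (A34 n)) \<longlonglongrightarrow> 0"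
        using tendsto_add[OF A_lim] by simp
      \<comment> \<open>Once \<open>?bound n\<close> has dropped below \<delta>, the event lies
        inside \<open>A12 n \<union> A34 n\<close>; it need not itself be measurable for the
        estimate.\<close>
      show "\<forall>\<^sub>F n in sequentially. measure (P n) {\<omega> \<in> space (P n). \<delta> < \<bar>X n \<omega> - 0\<bar>}
          \<le> measure (P n) (A12 n) + measure (P n) (A34 n)"
        using ev_main order_tendstoD(2)[OF bound_lim \<open>0 < \<delta>\<close>]
      proof eventually_elim
        case (elim n)
        then have "{\<omega> \<in> space (P n). \<delta> < \<bar>X n \<omega> - 0\<bar>} \<subseteq> A12 n \<union> A34 n"
          by force
        then show ?case
          using elim P[of n] by (intro measure_subset_union_le) auto
      qed
    qed auto
  qed
qed

end
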